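(* Let $k,\ell,s$ be positive integers with $k\geq 4$, $\ell\geq 3$ and $s\geq k\ell$. There is a constant $c(k,s)>0$ depending only on $k$ and $s$ such that the following holds for every $n$. Let $\mathcal{F}$ be a family of $k$-subsets of $[n]$. If $k=4$, suppose $\mathcal{F}$ contains no member of $\mathcal{C}^{(4)}_\ell$; if $k\geq 5$, suppose $\mathcal{F}$ does not contain $\mathbb{C}^{(k)}_\ell$. Then $\mathcal{F}$ can be partitioned into subfamilies $\mathcal{F}_1,\mathcal{F}_0$ such that $\mathcal{F}_1$ is centralized with threshold $s$ and $|\mathcal{F}_0|\leq \frac{1}{c(k,s)}\binom{n}{k-2}$.
   Context: An $s$-star with kernel $D$ is a collection of $s$ sets pairwise intersecting exactly in $D$, each strictly containing $D$. The kernel degree $\deg^*_{\mathcal{G}}(D)$ is the largest $s$ such that $\mathcal{G}$ contains an $s$-star with kernel $D$, and $\mathrm{Ker}_s(\mathcal{G})=\{D:\deg^*_{\mathcal{G}}(D)\geq s\}$. A family $\mathcal{G}$ is centralized with threshold $s$ if for every $F\in\mathcal{G}$ there is an element $c(F)\in F$ such that every proper subset $D\subsetneq F$ with $c(F)\in D$ belongs to $\mathrm{Ker}_s(\mathcal{G})$. $\mathbb{C}^{(k)}_\ell$ is the $k$-uniform linear cycle: $k$-sets $F_1,\dots,F_\ell$ and distinct vertices $v_1,\dots,v_\ell$ with $F_i\cap\{v_1,\dots,v_\ell\}=\{v_i,v_{i+1}\}$ (indices mod $\ell$) and the $F_i\setminus\{v_1,\dots,v_\ell\}$ pairwise disjoint.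 $\mathcal{C}^{(k)}_\ell$ is the family of $k$-uniform minimal cycles of length $\ell$: distinct $k$-sets $F_1,\dots,F_\ell$ and distinct vertices $v_1,\dots,v_\ell$ with $\{v_i,v_{i+1}\}\subseteq F_i$ (indices mod $\ell$) and $F_i\cap F_j=\emptyset$ for cyclically nonconsecutive $i,j$. *)

theory Defs
  imports Complex_Main
begin

definition is_star :: "nat \<Rightarrow> 'a set \<Rightarrow> 'a set set \<Rightarrow> bool" where
  "is_star s D S \<longleftrightarrow> finite S \<and> card S = s \<and> (\<forall>A\<in>S. D \<subset> A) \<and>
     (\<forall>A\<in>S. \<forall>B\<in>S. A \<noteq> B \<longrightarrow> A \<inter> B = D)"

text \<open>The maximum is meaningful for finite families \<open>G\<close>, the only ones considered: the set
  then is finite, and it contains 0 because the empty collection is a 0-star with any kernel.\<close>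

definition kernel_degree :: "'a set set \<Rightarrow> 'a set \<Rightarrow> nat" where
  "kernel_degree G D = Max {s. \<exists>S\<subseteq>G. is_star s D S}"

definition Ker :: "nat \<Rightarrow> 'a set set \<Rightarrow> 'a set set" where
  "Ker s G = {D. kernel_degree G D \<ge> s}"

definition centralized :: "nat \<Rightarrow> 'a set set \<Rightarrow> bool" where
  "centralized s G \<longleftrightarrow> (\<forall>F\<in>G. \<exists>c\<in>F. \<forall>D. D \<subset> F \<and> c \<in> D \<longrightarrow> D \<in> Ker s G)"

text \<open>Edges and vertices of cycles are indexed by \<open>0, \<dots>, l - 1\<close>. The set \<open>linear_cycles k l\<close>
  consists of all copies of the \<open>k\<close>-uniform linear cycle of length \<open>l\<close>.\<close>

definition linear_cycles :: "nat \<Rightarrow> nat \<Rightarrow> 'a set set set" where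
  "linear_cycles k l = {F ` {..<l} | F v.
     inj_on v {..<l} \<and>
     (\<forall>i<l. finite (F i) \<and> card (F i) = k) \<and>
     (\<forall>i<l. F i \<inter> v ` {..<l} = {v i, v (Suc i mod l)}) \<and>
     (\<forall>i<l. \<forall>j<l. i \<noteq> j \<longrightarrow> (F i - v ` {..<l}) \<inter> (F j - v ` {..<l}) = {})}"

definition minimal_cycles :: "nat \<Rightarrow> nat \<Rightarrow> 'a set set set" where
  "minimal_cycles k l = {F ` {..<l} | F v.
     inj_on F {..<l} \<and> inj_on v {..<l} \<and>
     (\<forall>i<l. finite (F i) \<and> card (F i) = k) \<and>
     (\<forall>i<l. {v i, v (Suc i mod l)} \<subseteq> F i) \<and>
     (\<forall>i<l. \<forall>j<l. i \<noteq> j \<and> j \<noteq> Suc i mod l \<and> i \<noteq> Suc j mod l \<longrightarrow> F i \<inter> F j = {})}"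

end

theory Submission imports Defs begin

text \<open>
  Call a set \<open>D\<close> a kernel of a family \<open>G\<close> if it is the kernel of a star of size \<open>s (k+1)^|D|\<close> in \<open>G\<close>.
  Repeatedly delete a member \<open>F\<close> of \<open>G\<close> for which the kernels inside \<open>F\<close> are not closed under
  intersection, or for which some \<open>F - {a, b}\<close> lies in no kernel properly contained in \<open>F\<close>.
  If \<open>D\<close> is not a kernel, its link has a cover of bounded size, and this bounds the number of
  deletions by \<open>O(binom n (k-2))\<close>. For a surviving \<open>F\<close> let \<open>A(F)\<close> be the set of \<open>a\<close> such
  that \<open>F - {a}\<close> is not a kernel; then every \<open>D \<subset> F\<close> that does not miss exactly one point of
  \<open>A(F)\<close> is a kernel.

  Every family with more than \<open>C binom n (k-2)\<close> members contains a nonempty surviving subfamily in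
  which \<open>A(F)\<close> is the trace \<open>F \<inter> S\<close> of a fixed set and has constant size \<open>m\<close>: if the deletion
  process, run also on the members whose \<open>A(F)\<close> is larger than prescribed, exhausts the family, then
  a degeneracy argument yields a proportional subfamily with a larger prescribed \<open>m\<close>.

  Let \<open>F1\<close> be a maximum centralized subfamily. If the rest were large, it would contain such a
  homogeneous subfamily. If \<open>m \<le> 1\<close> it is centralized, contradicting maximality. If \<open>m \<ge> 2\<close>, the
  pairs that are kernels form a graph in which cycles can be built one vertex at a time, and
  expanding the kernels of such a cycle gives the forbidden configuration.
\<close>

subsection \<open>Stars\<close>

definition has_star :: "nat \<Rightarrow> 'a set set \<Rightarrow> 'a set \<Rightarrow> bool" where
  "has_star t G D \<longleftrightarrow> (\<exists>S\<subseteq>G. is_star t D S)"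

lemma has_star_mono: "has_star t G D \<Longrightarrow> G \<subseteq> G' \<Longrightarrow> has_star t G' D"
  unfolding has_star_def by blast

lemma has_star_0: "has_star 0 G D"
  unfolding has_star_def is_star_def by (rule exI[of _ "{}"]) simp

lemma is_star_subset: "is_star t D S \<Longrightarrow> S' \<subseteq> S \<Longrightarrow> is_star (card S') D S'"
  unfolding is_star_def using finite_subset[of S' S] by (simp add: subset_iff)

lemma has_star_le:
  assumes "has_star t G D" "t' \<le> t"
  shows "has_star t' G D"
proof -
  obtain S where S: "S \<subseteq> G" "is_star t D S" using assms unfolding has_star_def by blast
  then have "t' \<le> card S" using assms by (simp add: is_star_def)
  then obtain S' where S': "S' \<subseteq> S" "card S' = t'" by (meson obtain_subset_with_card_n)
  have "is_star t' D S'" using is_star_subset[OF S(2) S'(1)] S'(2) by simp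
  moreover have "S' \<subseteq> G" using S'(1) S(1) by blast
  ultimately show ?thesis unfolding has_star_def by (intro exI[of _ S'] conjI)
qed

text \<open>The sizes of stars with kernel \<open>D\<close> in a finite family form a nonempty
  bounded set that is closed downwards, so its maximum reaches \<open>t\<close> exactly when a
  \<open>t\<close>-star exists.\<close>

lemma Ker_iff_has_star:
  assumes "finite G"
  shows "D \<in> Ker t G \<longleftrightarrow> has_star t G D"
proof -
  let ?M = "{s. has_star s G D}"
  have "?M \<subseteq> {..card G}"
  proof
    fix u assume "u \<in> ?M"
    then obtain S where "S \<subseteq> G" "is_star u D S" unfolding has_star_def by blast
    then have "S \<subseteq> G" "card S = u" by (simp_all add: is_star_def)
    then show "u \<in> {..card G}" using card_mono[OF assms, of S] by simp
  qed
  then have fin: "finite ?M" by (rule finite_subset) simp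
  have "0 \<in> ?M" by (simp add: has_star_0)
  then have "has_star (Max ?M) G D" using fin Max_in[of ?M] by blast
  then have "t \<le> Max ?M \<longleftrightarrow> has_star t G D" using fin has_star_le Max_ge[of ?M t] by blast
  moreover have "kernel_degree G D = Max ?M"
    by (simp add: kernel_degree_def has_star_def)
  ultimately show ?thesis by (simp add: Ker_def)
qed

text \<open>The petals \<open>A - D\<close> of a star are pairwise disjoint, so \<open>X\<close>
  meets fewer than \<open>t\<close> of them.\<close>

lemma star_avoiding:
  assumes "has_star t G D" "finite X" "card X < t"
  shows "\<exists>A\<in>G. D \<subset> A \<and> A \<inter> X \<subseteq> D"
proof (rule ccontr)
  assume stop: "\<not> ?thesis"
  obtain S where S: "S \<subseteq> G" "is_star t D S" using assms unfolding has_star_def by blast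
  have "\<exists>x. x \<in> A \<inter> X - D" if A: "A \<in> S" for A
  proof (rule ccontr)
    assume "\<not> ?thesis"
    then have "A \<inter> X \<subseteq> D" by blast
    moreover have "A \<in> G" "D \<subset> A" using S A unfolding is_star_def by blast+
    ultimately show False using stop by blast
  qed
  then obtain f where f: "\<And>A. A \<in> S \<Longrightarrow> f A \<in> A \<inter> X - D" by metis
  have "inj_on f S"
  proof (rule inj_onI)
    fix A B assume "A \<in> S" "B \<in> S" "f A = f B"
    moreover from this have "f A \<in> A \<inter> B" "f A \<notin> D" using f[of A] f[of B] by auto
    ultimately show "A = B" using S(2) unfolding is_star_def by metis
  qed
  then have "card S \<le> card X" using f assms(2) by (intro card_inj_on_le) auto
  then show False using S(2) assms(3) by (simp add: is_star_def)
qed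

section \<open>Uniform families and covers of links\<close>

definition unif :: "'a set \<Rightarrow> nat \<Rightarrow> 'a set set \<Rightarrow> bool" where
  "unif V k G \<longleftrightarrow> finite V \<and> (\<forall>F\<in>G. F \<subseteq> V \<and> card F = k)"

lemma unif_subset: "unif V k G \<Longrightarrow> G' \<subseteq> G \<Longrightarrow> unif V k G'"
  unfolding unif_def by blast

lemma unif_finite: "unif V k G \<Longrightarrow> finite G"
  unfolding unif_def by (rule finite_subset[of _ "Pow V"]) auto

lemma unif_memD:
  assumes "unif V k G" "F \<in> G"
  shows "finite F" "card F = k" "F \<subseteq> V"
proof -
  show "card F = k" "F \<subseteq> V" using assms unfolding unif_def by blast+
  then show "finite F" using assms unfolding unif_def by (meson finite_subset)
qed

text \<open>A largest star with kernel \<open>D\<close> has fewer than \<open>t\<close> members. Let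
  \<open>T\<close> be the union of its petals: a member that properly contains \<open>D\<close> and
  misses \<open>T\<close> would enlarge the star.\<close>

lemma link_cover:
  assumes "unif V k G" "\<not> has_star t G D"
  obtains T where "finite T" "card T \<le> k * t" "T \<inter> D = {}"
    "\<And>F. F \<in> G \<Longrightarrow> D \<subset> F \<Longrightarrow> F \<inter> T \<noteq> {}"
proof -
  let ?P = "\<lambda>u. has_star u G D"
  have 0: "?P 0" by (rule has_star_0)
  have lt: "u < t" if "?P u" for u using assms(2) has_star_le that by (meson not_less)
  obtain u where u: "?P u" "\<And>v. ?P v \<Longrightarrow> v \<le> u"
    using Nat.ex_has_greatest_nat[of ?P 0 t] 0 lt by (metis less_imp_le)
  obtain S where S: "S \<subseteq> G" "is_star u D S" using u(1) unfolding has_star_def by blast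
  define T where "T = \<Union>S - D"
  have fin: "finite S" "card S = u" using S(2) by (auto simp: is_star_def)
  have "finite T" using fin S(1) unif_memD(1)[OF assms(1)] unfolding T_def by blast
  moreover have "card T \<le> k * t"
  proof -
    have "card T \<le> card (\<Union>S)" unfolding T_def using fin S(1) unif_memD(1)[OF assms(1)]
      by (intro card_mono) auto
    also have "\<dots> \<le> sum card S" by (rule card_Union_le_sum_card)
    also have "\<dots> = k * u" using fin S(1) unif_memD(2)[OF assms(1)]
      by (subst sum.cong[OF refl, of S card "\<lambda>_. k"]) auto
    also have "\<dots> \<le> k * t" using lt[OF u(1)] by simp
    finally show ?thesis .
  qed
  moreover have "F \<inter> T \<noteq> {}" if F: "F \<in> G" "D \<subset> F" for F
  proof
    assume e: "F \<inter> T = {}"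
    then have "F \<notin> S" using F unfolding T_def by blast
    have FA: "F \<inter> A = D" if "A \<in> S" for A
    proof -
      have "D \<subset> A" using that S(2) unfolding is_star_def by blast
      then show ?thesis using e F that unfolding T_def by blast
    qed
    have "is_star (Suc u) D (insert F S)"
      unfolding is_star_def
    proof (intro conjI ballI impI)
      fix A B assume "A \<in> insert F S" "B \<in> insert F S" "A \<noteq> B"
      then show "A \<inter> B = D" using FA \<open>F \<notin> S\<close> S(2) unfolding is_star_def by (metis Int_commute insert_iff)
    qed (use S(2) F fin \<open>F \<notin> S\<close> in \<open>auto simp: is_star_def\<close>)
    then have "?P (Suc u)" using S(1) F unfolding has_star_def by blast
    then show False using u(2) by fastforce
  qed
  moreover have "T \<inter> D = {}" unfolding T_def by blast
  ultimately show ?thesis using that[of T] by blast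
qed

text \<open>Distinct \<open>k\<close>-sets through a common set \<open>D\<close> of size
  \<open>k - 1\<close> meet exactly in \<open>D\<close>, so \<open>Q\<close> is itself a
  star.\<close>

lemma codim1_star:
  assumes "unif V k G" "finite D" "Suc (card D) = k" "Q \<subseteq> G" "\<And>F. F \<in> Q \<Longrightarrow> D \<subseteq> F" "\<not> has_star t G D"
  shows "card Q < t"
proof (rule ccontr)
  assume le: "\<not> ?thesis"
  have "is_star (card Q) D Q"
    unfolding is_star_def
  proof (intro conjI ballI impI)
    show "finite Q" using assms unif_finite finite_subset by metis
    show "D \<subset> A" if "A \<in> Q" for A
      using assms that unif_memD[OF assms(1)] by (metis n_not_Suc_n psubsetI subsetD)
    show "A \<inter> B = D" if AB: "A \<in> Q" "B \<in> Q" "A \<noteq> B" for A B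
    proof -
      have f: "finite A" "finite B" "card A = k" "card B = k" using assms(4) AB unif_memD[OF assms(1)] by blast+
      have "\<not> A \<subseteq> B" using AB f card_subset_eq by metis
      then have "card (A \<inter> B) < k" using f by (metis Int_lower1 inf.absorb_iff1 psubsetI psubset_card_mono)
      then have "card (A \<inter> B) \<le> card D" using assms(3) by simp
      moreover have "D \<subseteq> A \<inter> B" using AB assms(5) by blast
      ultimately show ?thesis using f by (metis card_seteq finite_Int)
    qed
  qed simp
  then have "has_star (card Q) G D" using assms(4) has_star_def by blast
  then show False using assms(6) has_star_le le by (meson not_less)
qed

text \<open>The threshold grows by a factor \<open>k + 1\<close> with each point of
  \<open>D\<close>. The star of a kernel strictly above \<open>D\<close> therefore outnumbers the
  cover of size at most \<open>k * (s * (k + 1) ^ card D)\<close> that \<open>link_cover\<close>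
  yields when \<open>D\<close> is not a kernel.\<close>

definition kern :: "nat \<Rightarrow> nat \<Rightarrow> 'a set set \<Rightarrow> 'a set \<Rightarrow> bool" where
  "kern k s G D \<longleftrightarrow> has_star (s * (k + 1) ^ card D) G D"

lemma kern_mono: "kern k s G D \<Longrightarrow> G \<subseteq> G' \<Longrightarrow> kern k s G' D"
  unfolding kern_def by (rule has_star_mono)

lemma kern_has_star: "kern k s G D \<Longrightarrow> has_star s G D"
  unfolding kern_def by (erule has_star_le) simp

text \<open>\<open>H A\<close> is the family that is still present when \<open>A\<close> is deleted; the chosen \<open>A \<in> Q\<close> is the member
  of \<open>Q\<close> that is deleted first.\<close>

definition peel_order :: "('a \<Rightarrow> 'a set) \<Rightarrow> 'a set \<Rightarrow> bool" where
  "peel_order H R \<longleftrightarrow> (\<forall>Q\<subseteq>R. Q \<noteq> {} \<longrightarrow> (\<exists>A\<in>Q. Q \<subseteq> H A \<and> (\<forall>B\<in>Q. H B \<subseteq> H A)))"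

lemma peel_order_subset: "peel_order H R \<Longrightarrow> R' \<subseteq> R \<Longrightarrow> peel_order H R'"
  unfolding peel_order_def by blast

text \<open>Induction on the family: if some \<open>A\<close> is bad in \<open>F\<close>, it is
  deleted first, with \<open>H A = F\<close>, and the process goes on in \<open>F - {A}\<close>. It
  stops at a subfamily in which no member is bad.\<close>

lemma peeling:
  assumes "finite F"
  shows "\<exists>G H. G \<subseteq> F \<and> (\<forall>A\<in>G. \<not> bad G A) \<and> (\<forall>A\<in>F - G. bad (H A) A \<and> H A \<subseteq> F) \<and> peel_order H (F - G)"
  using assms
proof (induction F rule: finite_psubset_induct)
  case (psubset F)
  show ?case
  proof (cases "\<forall>A\<in>F. \<not> bad F A")
    case True
    then show ?thesis by (intro exI[of _ F]) (auto simp: peel_order_def)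
  next
    case False
    then obtain A where A: "A \<in> F" "bad F A" by blast
    then have "F - {A} \<subset> F" by blast
    from psubset.IH[OF this] obtain G H where
      G: "G \<subseteq> F - {A}" "\<forall>B\<in>G. \<not> bad G B" "\<forall>B\<in>F - {A} - G. bad (H B) B \<and> H B \<subseteq> F - {A}"
        and H: "peel_order H (F - {A} - G)" by blast
    let ?H = "H(A := F)"
    have "\<forall>B\<in>F - G. bad (?H B) B \<and> ?H B \<subseteq> F" using G A by auto
    moreover have "peel_order ?H (F - G)"
      unfolding peel_order_def
    proof (intro allI impI)
      fix Q assume Q: "Q \<subseteq> F - G" "Q \<noteq> {}"
      show "\<exists>B\<in>Q. Q \<subseteq> ?H B \<and> (\<forall>C\<in>Q. ?H C \<subseteq> ?H B)"
      proof (cases "A \<in> Q")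
        case True
        then show ?thesis using Q G by (intro bexI[of _ A]) auto
      next
        case False
        then have "Q \<subseteq> F - {A} - G" using Q by blast
        then obtain B where "B \<in> Q" "Q \<subseteq> H B" "\<forall>C\<in>Q. H C \<subseteq> H B"
          using H Q unfolding peel_order_def by meson
        then show ?thesis using False by (intro bexI[of _ B]) auto
      qed
    qed
    ultimately show ?thesis using G by (intro exI[of _ G] exI[of _ ?H]) blast
  qed
qed

subsection \<open>Counting deletions\<close>

text \<open>The failing set \<open>D\<close> is an explicit argument so that deleted members can be
  counted fibre by fibre over it.\<close>

definition meet_defect :: "nat \<Rightarrow> nat \<Rightarrow> 'a set set \<Rightarrow> 'a set \<Rightarrow> 'a set \<Rightarrow> bool" where
  "meet_defect k s G F D \<longleftrightarrow> \<not> kern k s G D \<and>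
     (\<exists>D1 D2. D1 \<subset> F \<and> D2 \<subset> F \<and> kern k s G D1 \<and> kern k s G D2 \<and> D = D1 \<inter> D2)"

definition cover_defect :: "nat \<Rightarrow> nat \<Rightarrow> 'a set set \<Rightarrow> 'a set \<Rightarrow> 'a set \<Rightarrow> bool" where
  "cover_defect k s G F D \<longleftrightarrow> \<not> kern k s G D \<and>
     (\<exists>a b. a \<in> F \<and> b \<in> F \<and> a \<noteq> b \<and> D = F - {a, b} \<and> \<not> kern k s G (F - {a}) \<and> \<not> kern k s G (F - {b}))"

lemma cover_defectE:
  assumes "cover_defect k s G F D"
  obtains a b where "a \<in> F" "b \<in> F" "a \<noteq> b" "D = F - {a, b}" "\<not> kern k s G D"
    "\<not> kern k s G (F - {a})" "\<not> kern k s G (F - {b})"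
proof -
  from assms have "\<not> kern k s G D"
    and "\<exists>a b. a \<in> F \<and> b \<in> F \<and> a \<noteq> b \<and> D = F - {a, b} \<and> \<not> kern k s G (F - {a}) \<and> \<not> kern k s G (F - {b})"
    unfolding cover_defect_def by (rule conjunct1, rule conjunct2)
  then show ?thesis by (elim exE conjE) (rule that)
qed

lemma pow_bound:
  assumes "j \<le> k"
  shows "s * (k + 1) ^ j \<le> s * (k + 1) ^ (k::nat)"
  using assms by (intro mult_le_mono2 power_increasing) simp_all

text \<open>The member \<open>A\<close> of \<open>R\<close> deleted first sees the largest of the
  families \<open>H F\<close>, so one cover of the link of \<open>D\<close> in \<open>H A\<close>
  serves all of \<open>R\<close>.\<close>

lemma first_cover:
  assumes "unif V k G" "peel_order H R" "R \<noteq> {}" "\<And>F. F \<in> R \<Longrightarrow> H F \<subseteq> G \<and> \<not> kern k s (H F) D \<and> D \<subset> F"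
  obtains A T where "A \<in> R" "R \<subseteq> H A" "\<And>B. B \<in> R \<Longrightarrow> H B \<subseteq> H A"
    "finite T" "card T \<le> k * (s * (k + 1) ^ card D)" "T \<inter> D = {}"
    "\<And>F. F \<in> H A \<Longrightarrow> D \<subset> F \<Longrightarrow> F \<inter> T \<noteq> {}"
proof -
  obtain A where A: "A \<in> R" "R \<subseteq> H A" "\<forall>B\<in>R. H B \<subseteq> H A"
    using assms(2)[unfolded peel_order_def, rule_format, OF subset_refl assms(3)] by blast
  have "unif V k (H A)" using unif_subset[OF assms(1)] assms(4)[OF A(1)] by blast
  moreover have "\<not> has_star (s * (k + 1) ^ card D) (H A) D" using assms(4)[OF A(1)] unfolding kern_def by blast
  ultimately obtain T where T: "finite T" "card T \<le> k * (s * (k + 1) ^ card D)" "T \<inter> D = {}"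
    "\<And>F. F \<in> H A \<Longrightarrow> D \<subset> F \<Longrightarrow> F \<inter> T \<noteq> {}" by (rule link_cover) blast
  show ?thesis by (rule that[OF A(1,2) _ T]) (use A(3) in auto)
qed

text \<open>The kernels \<open>D1\<close> and \<open>D2\<close> lie strictly above \<open>D\<close>,
  and their stars are too large to be blocked by a cover \<open>T\<close> of the link of
  \<open>D\<close>, so each of them meets \<open>T\<close>. The two points found lie outside
  \<open>D = D1 \<inter> D2\<close> and hence differ.\<close>

lemma meet_defect_cover:
  assumes G: "unif V k G" and P: "peel_order H R" and s: "s > 0"
    and R: "\<And>F. F \<in> R \<Longrightarrow> H F \<subseteq> G \<and> F \<in> G \<and> meet_defect k s (H F) F D"
  shows "\<exists>T. finite T \<and> card T \<le> k * (s * (k + 1) ^ k) \<and>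
    (\<forall>F\<in>R. \<exists>x\<in>T. \<exists>y\<in>T. x \<noteq> y \<and> x \<in> F - D \<and> y \<in> F - D)"
proof (cases "R = {}")
  case True
  then show ?thesis by (intro exI[of _ "{}"]) auto
next
  case False
  have DF: "D \<subset> F" if F: "F \<in> R" for F
  proof -
    obtain D1 D2 where "D1 \<subset> F" "D = D1 \<inter> D2" using R[OF F] unfolding meet_defect_def by metis
    then show ?thesis by blast
  qed
  obtain A T where A: "A \<in> R" "R \<subseteq> H A" "\<And>B. B \<in> R \<Longrightarrow> H B \<subseteq> H A"
    and T: "finite T" "card T \<le> k * (s * (k + 1) ^ card D)" "T \<inter> D = {}"
    "\<And>F. F \<in> H A \<Longrightarrow> D \<subset> F \<Longrightarrow> F \<inter> T \<noteq> {}"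
    by (rule first_cover[OF G P False, of s D]) (use R DF in \<open>simp_all add: meet_defect_def\<close>)
  have "card D \<le> k" using DF[OF A(1)] R[OF A(1)] unif_memD[OF G]
    by (metis card_mono psubset_imp_subset)
  then have "card T \<le> k * (s * (k + 1) ^ k)"
    using T(2) pow_bound[of "card D" k s] by (meson le_trans mult_le_mono2)
  moreover have "\<exists>x\<in>T. \<exists>y\<in>T. x \<noteq> y \<and> x \<in> F - D \<and> y \<in> F - D" if F: "F \<in> R" for F
  proof -
    obtain D1 D2 where D: "D1 \<subset> F" "D2 \<subset> F" "kern k s (H F) D1" "kern k s (H F) D2" "D = D1 \<inter> D2"
      "\<not> kern k s (H F) D"
      using R[OF F] unfolding meet_defect_def by blast
    have hit: "E \<inter> T \<noteq> {}" if E: "E \<subset> F" "kern k s (H F) E" "D \<subset> E" for E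
    proof
      assume e: "E \<inter> T = {}"
      have "finite E" using E(1) unif_memD(1)[OF G] R[OF F] by (meson finite_subset psubset_imp_subset)
      then have "card D < card E" using E(3) psubset_card_mono by blast
      \<comment> \<open>One more point in \<open>E\<close> than in \<open>D\<close> makes its star
        larger than \<open>T\<close>. A member of that star meeting \<open>T\<close> only inside
        \<open>E\<close> would miss \<open>T\<close> altogether, although it contains
        \<open>D\<close>.\<close>
      then have "(k+1) ^ Suc (card D) \<le> (k+1) ^ card E" by (intro power_increasing) auto
      then have "s * ((k+1) * (k + 1) ^ card D) \<le> s * (k+1) ^ card E" by simp
      moreover have "k * (s * (k + 1) ^ card D) < s * ((k+1) * (k + 1) ^ card D)" using s by simp
      ultimately have lt: "card T < s * (k+1) ^ card E" using T(2) by linarith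
      have "has_star (s * (k+1) ^ card E) (H A) E"
        using kern_mono[OF E(2) A(3)[OF F]] unfolding kern_def .
      from star_avoiding[OF this T(1) lt] obtain B where "B \<in> H A" "E \<subset> B" "B \<inter> T \<subseteq> E" by blast
      then show False using T(4)[of B] E(3) e by blast
    qed
    have "D \<noteq> D1" "D \<noteq> D2" using D(3,4,6) by metis+
    then have "D \<subset> D1" "D \<subset> D2" using D(5) by auto
    then obtain x y where "x \<in> D1 \<inter> T" "y \<in> D2 \<inter> T" using hit[OF D(1,3)] hit[OF D(2,4)] by blast
    then show ?thesis using D T(3) by (intro bexI[of _ x] bexI[of _ y]) auto
  qed
  ultimately show ?thesis using T(1) by blast
qed

lemma card_UN_le_mult:
  assumes "finite I" "\<And>i. i \<in> I \<Longrightarrow> card (f i) \<le> M"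
  shows "card (\<Union>i\<in>I. f i) \<le> card I * M"
proof -
  have "card (\<Union>i\<in>I. f i) \<le> (\<Sum>i\<in>I. card (f i))" using assms(1) by (rule card_UN_le)
  also have "\<dots> \<le> (\<Sum>i\<in>I. M)" using assms(2) by (rule sum_mono)
  finally show ?thesis by simp
qed

lemma meet_defect_count:
  assumes G: "unif V k G" and P: "peel_order H R" and s: "s > 0"
    and R: "\<And>F. F \<in> R \<Longrightarrow> H F \<subseteq> G \<and> F \<in> G \<and> (\<exists>D. meet_defect k s (H F) F D)"
  shows "card R \<le> (card V choose (k - 2)) * (2 ^ (k - 2) * (k * (s * (k + 1) ^ k))\<^sup>2)"
proof -
  let ?M = "k * (s * (k + 1) ^ k)"
  have "\<exists>T. finite T \<and> card T \<le> ?M \<and>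
    (\<forall>F\<in>{F \<in> R. meet_defect k s (H F) F D}. \<exists>x\<in>T. \<exists>y\<in>T. x \<noteq> y \<and> x \<in> F - D \<and> y \<in> F - D)" for D
    using R by (intro meet_defect_cover[OF G peel_order_subset[OF P] s]) auto
  then obtain T where T: "\<And>D. finite (T D)" "\<And>D. card (T D) \<le> ?M"
    "\<And>D F. F \<in> R \<Longrightarrow> meet_defect k s (H F) F D \<Longrightarrow> \<exists>x\<in>T D. \<exists>y\<in>T D. x \<noteq> y \<and> x \<in> F - D \<and> y \<in> F - D"
    unfolding Ball_def mem_Collect_eq by metis
  let ?E = "{E. E \<subseteq> V \<and> card E = k - 2}"
  \<comment> \<open>A deleted \<open>F\<close> is determined by \<open>E = F - {x, y}\<close>, \<open>D \<subseteq> E\<close> and the pair \<open>x, y\<close> in the cover of the link of \<open>D\<close>.\<close>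
  define U where "U = (\<Union>E\<in>?E. \<Union>D\<in>Pow E. (\<lambda>(x,y). insert x (insert y E)) ` (T D \<times> T D))"
  have finV: "finite V" using G by (simp add: unif_def)
  have finE: "finite ?E" by (rule finite_subset[of _ "Pow V"]) (use finV in auto)
  have "R \<subseteq> U"
  proof
    fix F assume F: "F \<in> R"
    then obtain D where D: "meet_defect k s (H F) F D" using R by blast
    then obtain x y where xy: "x \<in> T D" "y \<in> T D" "x \<noteq> y" "x \<in> F - D" "y \<in> F - D" using T F by blast
    have f: "finite F" "card F = k" "F \<subseteq> V" using unif_memD[OF G] R[OF F] by blast+
    have "card (F - {x,y}) = k - 2" using f xy by (simp add: card_Diff_subset)
    moreover have "D \<subseteq> F - {x,y}" using D xy unfolding meet_defect_def by blast
    ultimately show "F \<in> U" unfolding U_def using xy f(3)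
      by (intro UN_I[of "F - {x,y}"] UN_I[of D] image_eqI[of _ _ "(x,y)"]) auto
  qed
  moreover have finPow: "finite (Pow E)" if "E \<in> ?E" for E using that finV finite_subset by auto
  ultimately have "card R \<le> card U" unfolding U_def using finE T(1)
    by (intro card_mono finite_UN_I) (auto intro: finite_subset)
  also have "card U \<le> card ?E * (2 ^ (k - 2) * ?M\<^sup>2)"
    unfolding U_def
  proof (rule card_UN_le_mult[OF finE])
    fix E assume E: "E \<in> ?E"
    have "card (\<Union>D\<in>Pow E. (\<lambda>(x,y). insert x (insert y E)) ` (T D \<times> T D)) \<le> card (Pow E) * ?M\<^sup>2"
    proof (rule card_UN_le_mult[OF finPow[OF E]])
      fix D
      have "card ((\<lambda>(x,y). insert x (insert y E)) ` (T D \<times> T D)) \<le> card (T D \<times> T D)"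
        by (rule card_image_le) (simp add: T)
      also have "\<dots> \<le> ?M\<^sup>2" unfolding card_cartesian_product power2_eq_square by (intro mult_le_mono T)
      finally show "card ((\<lambda>(x,y). insert x (insert y E)) ` (T D \<times> T D)) \<le> ?M\<^sup>2" .
    qed
    moreover have "card (Pow E) = 2 ^ (k - 2)" using E finV by (simp add: card_Pow finite_subset[of E V])
    ultimately show "card (\<Union>D\<in>Pow E. (\<lambda>(x,y). insert x (insert y E)) ` (T D \<times> T D)) \<le> 2 ^ (k - 2) * ?M\<^sup>2"
      by metis
  qed
  also have "card ?E = card V choose (k - 2)" using finV by (rule n_subsets)
  finally show ?thesis .
qed

text \<open>Every \<open>F\<close> in \<open>R\<close> meets a bounded cover \<open>T\<close> of the
  link of \<open>D\<close> in some \<open>x\<close>. Since \<open>F - D\<close> has only two points,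
  \<open>insert x D\<close> is \<open>F\<close> minus a point and is not a kernel, so few members
  share the same \<open>x\<close>.\<close>

lemma cover_defect_fibre:
  assumes G: "unif V k G" and P: "peel_order H R"
    and R: "\<And>F. F \<in> R \<Longrightarrow> H F \<subseteq> G \<and> F \<in> G \<and> cover_defect k s (H F) F D"
  shows "card R \<le> k * (s * (k + 1) ^ k) * (s * (k + 1) ^ k)"
proof (cases "R = {}")
  case True
  show ?thesis unfolding True card.empty by (rule le0)
next
  case False
  have DF: "D \<subset> F" if F: "F \<in> R" for F
  proof -
    have "cover_defect k s (H F) F D" using R[OF F] by simp
    then show ?thesis by (rule cover_defectE) blast
  qed
  have "H F \<subseteq> G \<and> \<not> kern k s (H F) D \<and> D \<subset> F" if "F \<in> R" for F
    using R[OF that] DF[OF that] unfolding cover_defect_def by simp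
  then obtain A T where A: "A \<in> R" "R \<subseteq> H A" "\<And>B. B \<in> R \<Longrightarrow> H B \<subseteq> H A"
    and T: "finite T" "card T \<le> k * (s * (k + 1) ^ card D)" "T \<inter> D = {}"
    "\<And>F. F \<in> H A \<Longrightarrow> D \<subset> F \<Longrightarrow> F \<inter> T \<noteq> {}"
    by (rule first_cover[OF G P False, of s D]) simp_all
  have "card D \<le> k" using DF[OF A(1)] R[OF A(1)] unif_memD[OF G]
    by (metis card_mono psubset_imp_subset)
  then have cT: "card T \<le> k * (s * (k + 1) ^ k)"
    using T(2) pow_bound[of "card D" k s] by (meson le_trans mult_le_mono2)
  have "R \<subseteq> (\<Union>x\<in>T. {F \<in> R. x \<in> F})" using T(4) A(2) DF by blast
  moreover have "finite R" using R unif_finite[OF G] by (meson finite_subset subsetI)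
  ultimately have "card R \<le> card (\<Union>x\<in>T. {F \<in> R. x \<in> F})" using T(1) by (intro card_mono) auto
  also have "\<dots> \<le> card T * (s * (k + 1) ^ k)"
  proof (rule card_UN_le_mult[OF T(1)])
    fix x assume x: "x \<in> T"
    let ?Q = "{F \<in> R. x \<in> F}"
    show "card ?Q \<le> s * (k + 1) ^ k"
    proof (cases "?Q = {}")
      case True
      then show ?thesis by (metis card.empty le0)
    next
      case False
      \<comment> \<open>\<open>B\<close> is deleted first among the members containing
        \<open>x\<close>, so all of them are still present in \<open>H B\<close>, where
        \<open>insert x D\<close> fails to be a kernel.\<close>
      then obtain B where B: "B \<in> ?Q" "?Q \<subseteq> H B"
        using P[unfolded peel_order_def, rule_format, of ?Q] by blast
      have "cover_defect k s (H B) B D" using R[of B] B(1) by simp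
      then obtain a b where ab: "a \<in> B" "b \<in> B" "a \<noteq> b" "D = B - {a,b}" "\<not> kern k s (H B) (B - {a})"
         "\<not> kern k s (H B) (B - {b})" by (rule cover_defectE)
      have f: "finite B" "card B = k" using unif_memD[OF G] R[of B] B(1) by blast+
      have "x \<notin> D" using x T(3) by blast
      then have "x = a \<or> x = b" using B(1) ab by blast
      then have D': "insert x D = B - {a} \<or> insert x D = B - {b}" using ab by blast
      then have nk: "\<not> kern k s (H B) (insert x D)" using ab by metis
      have c: "Suc (card (insert x D)) = k" using D'
      proof
        assume "insert x D = B - {a}"
        then show ?thesis using f ab(1) card_Suc_Diff1 by metis
      next
        assume "insert x D = B - {b}"
        then show ?thesis using f ab(2) card_Suc_Diff1 by metis
      qed
      have "card ?Q < s * (k + 1) ^ card (insert x D)"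
      proof (rule codim1_star[OF _ _ c B(2)])
        show "unif V k (H B)" using unif_subset[OF G] R[of B] B(1) by simp
        show "finite (insert x D)" using f(1) ab(4) by simp
        show "\<not> has_star (s * (k + 1) ^ card (insert x D)) (H B) (insert x D)" using nk unfolding kern_def .
        show "insert x D \<subseteq> F" if "F \<in> ?Q" for F using that DF[of F] by blast
      qed
      then show ?thesis using c pow_bound[of "card (insert x D)" k s] by linarith
    qed
  qed
  also have "\<dots> \<le> k * (s * (k + 1) ^ k) * (s * (k + 1) ^ k)" using cT by (rule mult_le_mono1)
  finally show ?thesis .
qed

text \<open>Here \<open>D\<close> itself has \<open>k - 2\<close> points, so it suffices to sum the
  bounded fibres over all such \<open>D\<close>.\<close>

lemma cover_defect_count:
  assumes G: "unif V k G" and P: "peel_order H R"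
    and R: "\<And>F. F \<in> R \<Longrightarrow> H F \<subseteq> G \<and> F \<in> G \<and> (\<exists>D. cover_defect k s (H F) F D)"
  shows "card R \<le> (card V choose (k - 2)) * (k * (s * (k + 1) ^ k) * (s * (k + 1) ^ k))"
proof -
  let ?E = "{E. E \<subseteq> V \<and> card E = k - 2}"
  define U where "U = (\<Union>D\<in>?E. {F \<in> R. cover_defect k s (H F) F D})"
  have finV: "finite V" using G by (simp add: unif_def)
  have finE: "finite ?E" by (rule finite_subset[of _ "Pow V"]) (use finV in auto)
  have finR: "finite R" using R unif_finite[OF G] by (meson finite_subset subsetI)
  have "R \<subseteq> U"
  proof
    fix F assume F: "F \<in> R"
    then obtain D where D: "cover_defect k s (H F) F D" using R by blast
    then obtain a b where ab: "a \<in> F" "b \<in> F" "a \<noteq> b" "D = F - {a,b}" by (rule cover_defectE)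
    have f: "finite F" "card F = k" "F \<subseteq> V" using unif_memD[OF G] R[OF F] by blast+
    have "card D = k - 2" using f ab by (simp add: card_Diff_subset)
    moreover have "D \<subseteq> V" using ab f(3) by blast
    ultimately show "F \<in> U" unfolding U_def using F D by blast
  qed
  then have "card R \<le> card U" unfolding U_def using finE finR by (intro card_mono) auto
  also have "card U \<le> card ?E * (k * (s * (k + 1) ^ k) * (s * (k + 1) ^ k))"
    unfolding U_def
  proof (rule card_UN_le_mult[OF finE])
    fix D
    show "card {F \<in> R. cover_defect k s (H F) F D} \<le> k * (s * (k + 1) ^ k) * (s * (k + 1) ^ k)"
      by (rule cover_defect_fibre[OF G peel_order_subset[OF P]]) (use R in auto)
  qed
  also have "card ?E = card V choose (k - 2)" using finV by (rule n_subsets)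
  finally show ?thesis .
qed

subsection \<open>Homogeneous subfamilies\<close>

text \<open>This is the set \<open>A(F)\<close> of the introduction, taken relative to the family
  \<open>G\<close>.\<close>

definition free_pts :: "nat \<Rightarrow> nat \<Rightarrow> 'a set set \<Rightarrow> 'a set \<Rightarrow> 'a set" where
  "free_pts k s G F = {a \<in> F. \<not> kern k s G (F - {a})}"

definition settled :: "nat \<Rightarrow> nat \<Rightarrow> 'a set set \<Rightarrow> 'a set \<Rightarrow> bool" where
  "settled k s G F \<longleftrightarrow> (\<forall>D. \<not> meet_defect k s G F D) \<and> (\<forall>D. \<not> cover_defect k s G F D)"

text \<open>Consider the nonempty \<open>T\<close> for which \<open>F - T\<close> is a kernel.
  Without meet defects they are closed under union; they include the singletons outside the free
  points and, without cover defects, the pairs of free points. Unions of these give every nonempty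
  \<open>T\<close> that does not contain exactly one free point.\<close>

lemma settled_kern:
  assumes F: "settled k s G F" "finite F" and D: "D \<subset> F" "card ((F - D) \<inter> free_pts k s G F) \<noteq> 1"
  shows "kern k s G D"
proof -
  let ?A = "free_pts k s G F"
  let ?K = "\<lambda>T. kern k s G (F - T)"
  have un: "?K (T1 \<union> T2)" if "T1 \<subseteq> F" "T1 \<noteq> {}" "T2 \<subseteq> F" "T2 \<noteq> {}" "?K T1" "?K T2" for T1 T2
  proof -
    have "F - T1 \<subset> F" "F - T2 \<subset> F" using that(1-4) by blast+
    moreover have "\<not> meet_defect k s G F ((F - T1) \<inter> (F - T2))" using F(1) unfolding settled_def by simp
    ultimately have "kern k s G ((F - T1) \<inter> (F - T2))" using that(5,6) unfolding meet_defect_def by metis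
    moreover have "F - (T1 \<union> T2) = (F - T1) \<inter> (F - T2)" by blast
    ultimately show ?thesis by simp
  qed
  have out: "?K U" if "finite U" "U \<noteq> {}" "U \<subseteq> F - ?A" for U
    using that
  proof (induction U rule: finite_ne_induct)
    case (singleton x)
    then show ?case unfolding free_pts_def by blast
  next
    case (insert x U)
    have "?K {x}" using insert.prems unfolding free_pts_def by blast
    then have "?K ({x} \<union> U)" using insert by (intro un) auto
    then show ?case by simp
  qed
  have pair: "?K {a, b}" if ab: "a \<in> ?A" "b \<in> ?A" "a \<noteq> b" for a b
  proof (rule ccontr)
    assume "\<not> ?thesis"
    then have "cover_defect k s G F (F - {a, b})"
      unfolding cover_defect_def using ab by (intro conjI exI[of _ a] exI[of _ b]) (simp_all add: free_pts_def)
    then show False using F(1) unfolding settled_def by simp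
  qed
  have ins: "?K (insert a U)" if "finite U" "U \<noteq> {}" "a \<in> ?A" "U \<subseteq> ?A - {a}" for a U
    using that
  proof (induction U rule: finite_ne_induct)
    case (singleton x)
    then show ?case using pair[of a x] by auto
  next
    case (insert x U)
    have "?A \<subseteq> F" unfolding free_pts_def by blast
    moreover have "?K {a, x}" using insert.prems pair[of a x] by auto
    moreover have "?K (insert a U)" using insert by blast
    ultimately have "?K ({a, x} \<union> insert a U)" using insert.prems by (intro un) auto
    then show ?case by (simp add: insert_commute)
  qed
  let ?T = "F - D"
  have A: "?A \<subseteq> F" unfolding free_pts_def by blast
  have fin: "finite (?T \<inter> ?A)" "finite (?T - ?A)" using F(2) by auto
  have K1: "?K (?T \<inter> ?A)" if ne: "?T \<inter> ?A \<noteq> {}"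
  proof -
    obtain a where a: "a \<in> ?T \<inter> ?A" using ne by blast
    have "?T \<inter> ?A - {a} \<noteq> {}"
    proof
      assume "?T \<inter> ?A - {a} = {}"
      then have "?T \<inter> ?A = {a}" using a by blast
      then show False using D(2) by simp
    qed
    then have "?K (insert a (?T \<inter> ?A - {a}))" using a fin by (intro ins) auto
    moreover have "insert a (?T \<inter> ?A - {a}) = ?T \<inter> ?A" using a by blast
    ultimately show ?thesis by simp
  qed
  have K2: "?K (?T - ?A)" if "?T - ?A \<noteq> {}" using that fin by (intro out) auto
  have DT: "F - ?T = D" using D(1) by blast
  have "?K ?T"
  proof (cases "?T \<inter> ?A = {}")
    case True
    then have "?T - ?A = ?T" by blast
    moreover have "?T \<noteq> {}" using D(1) by blast
    ultimately show ?thesis using K2 by metis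
  next
    case ne1: False
    show ?thesis
    proof (cases "?T - ?A = {}")
      case True
      then have "?T \<inter> ?A = ?T" by blast
      then show ?thesis using K1 ne1 by metis
    next
      case False
      have "?K ((?T \<inter> ?A) \<union> (?T - ?A))"
        by (rule un[OF _ ne1 _ False K1[OF ne1] K2[OF False]]) auto
      moreover have "(?T \<inter> ?A) \<union> (?T - ?A) = ?T" by blast
      ultimately show ?thesis by metis
    qed
  qed
  then show ?thesis using DT by metis
qed

text \<open>Averaging over all \<open>S \<subseteq> V\<close>: for each fixed \<open>F\<close>, at
  least a fraction \<open>1 / 2 ^ k\<close> of these sets has the prescribed trace on
  \<open>F\<close>.\<close>

lemma exists_trace_set:
  assumes V: "finite V" and R: "finite R" "\<And>F. F \<in> R \<Longrightarrow> F \<subseteq> V \<and> card F = k \<and> B F \<subseteq> F"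
  shows "\<exists>S. card R \<le> 2 ^ k * card {F \<in> R. F \<inter> S = B F}"
proof (rule ccontr)
  assume "\<not> ?thesis"
  then have lt: "2 ^ k * card {F \<in> R. F \<inter> S = B F} < card R" for S by (meson not_le)
  let ?X = "SIGMA F:R. {S \<in> Pow V. F \<inter> S = B F}"
  have one: "2 ^ card V \<le> 2 ^ k * card {S \<in> Pow V. F \<inter> S = B F}" if F: "F \<in> R" for F
  proof -
    have f: "F \<subseteq> V" "card F = k" "B F \<subseteq> F" using R(2)[OF F] by auto
    have finF: "finite F" using f(1) V finite_subset by blast
    have inj: "inj_on (\<lambda>X. B F \<union> X) (Pow (V - F))"
    proof (rule inj_onI)
      fix X Y assume "X \<in> Pow (V - F)" "Y \<in> Pow (V - F)" and e: "B F \<union> X = B F \<union> Y"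
      then have "X \<inter> B F = {}" "Y \<inter> B F = {}" using f(3) by auto
      then show "X = Y" using e by blast
    qed
    have "(\<lambda>X. B F \<union> X) ` Pow (V - F) \<subseteq> {S \<in> Pow V. F \<inter> S = B F}" using f by auto
    then have "card (Pow (V - F)) \<le> card {S \<in> Pow V. F \<inter> S = B F}"
      using card_inj_on_le[OF inj] V by simp
    moreover have "card (Pow (V - F)) = 2 ^ (card V - k)" using f V finF by (simp add: card_Pow card_Diff_subset)
    moreover have "card V = k + (card V - k)" using f card_mono[OF V] by fastforce
    then have "(2::nat) ^ card V = 2 ^ k * 2 ^ (card V - k)" by (metis power_add)
    ultimately show ?thesis by simp
  qed
  have "card R * 2 ^ card V = (\<Sum>F\<in>R. 2 ^ card V)" by simp
  also have "\<dots> \<le> (\<Sum>F\<in>R. 2 ^ k * card {S \<in> Pow V. F \<inter> S = B F})" by (rule sum_mono[OF one])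
  also have "\<dots> = 2 ^ k * (\<Sum>F\<in>R. card {S \<in> Pow V. F \<inter> S = B F})" by (simp add: sum_distrib_left)
  also have "(\<Sum>F\<in>R. card {S \<in> Pow V. F \<inter> S = B F}) = (\<Sum>S\<in>Pow V. card {F \<in> R. F \<inter> S = B F})"
    using sum.swap_restrict[OF R(1), of "Pow V" "\<lambda>_ _. 1::nat" "\<lambda>F S. F \<inter> S = B F"] V by simp
  also have "2 ^ k * \<dots> = (\<Sum>S\<in>Pow V. 2 ^ k * card {F \<in> R. F \<inter> S = B F})" by (simp add: sum_distrib_left)
  also have "\<dots> < (\<Sum>S\<in>Pow V. card R)" using V lt by (intro sum_strict_mono) auto
  also have "\<dots> = card R * 2 ^ card V" using V by (simp add: card_Pow)
  finally show False by simp
qed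

text \<open>Greedy choice: pick a member with at most \<open>d\<close> neighbours, discard these
  neighbours and continue with the rest.\<close>

lemma degenerate_independent:
  assumes "finite R" "\<And>Q. Q \<subseteq> R \<Longrightarrow> Q \<noteq> {} \<Longrightarrow> \<exists>A\<in>Q. card {B \<in> Q. B \<noteq> A \<and> (E A B \<or> E B A)} \<le> d"
  shows "\<exists>I\<subseteq>R. (\<forall>A\<in>I. \<forall>B\<in>I. A \<noteq> B \<longrightarrow> \<not> E A B) \<and> card R \<le> (d + 1) * card I"
  using assms
proof (induction R rule: finite_psubset_induct)
  case (psubset R)
  show ?case
  proof (cases "R = {}")
    case True
    then show ?thesis by simp
  next
    case False
    then obtain A where A: "A \<in> R" "card {B \<in> R. B \<noteq> A \<and> (E A B \<or> E B A)} \<le> d"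
      using psubset.prems[of R] by blast
    let ?N = "{B \<in> R. B \<noteq> A \<and> (E A B \<or> E B A)}"
    let ?R = "R - insert A ?N"
    have "?R \<subset> R" using A by blast
    moreover have "\<exists>A\<in>Q. card {B \<in> Q. B \<noteq> A \<and> (E A B \<or> E B A)} \<le> d" if "Q \<subseteq> ?R" "Q \<noteq> {}" for Q
      using psubset.prems[of Q] that by blast
    ultimately obtain I where I: "I \<subseteq> ?R" "\<forall>A\<in>I. \<forall>B\<in>I. A \<noteq> B \<longrightarrow> \<not> E A B" "card ?R \<le> (d + 1) * card I"
      using psubset.IH[of ?R] by blast
    have finR: "finite R" using psubset by simp
    have finI: "finite I" using I(1) finR finite_subset by blast
    have "A \<notin> I" using I(1) by blast
    then have cI: "card (insert A I) = card I + 1" using finI by simp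
    have "card R \<le> card (?R \<union> insert A ?N)" using finR by (intro card_mono) auto
    also have "\<dots> \<le> card ?R + card (insert A ?N)" by (rule card_Un_le)
    also have "card (insert A ?N) \<le> d + 1" using A(2) card_insert_le_m1[of "d+1" ?N A] by simp
    finally have "card R \<le> (d + 1) * card I + (d + 1)" using I(3) by linarith
    then have "card R \<le> (d + 1) * card (insert A I)" unfolding cI by simp
    moreover have "\<forall>X\<in>insert A I. \<forall>B\<in>insert A I. X \<noteq> B \<longrightarrow> \<not> E X B" using I(1,2) by blast
    moreover have "insert A I \<subseteq> R" using I(1) A(1) by blast
    ultimately show ?thesis by blast
  qed
qed

section \<open>Homogeneous families and the growth of the trace\<close>

definition homog :: "nat \<Rightarrow> nat \<Rightarrow> 'a set set \<Rightarrow> 'a set \<Rightarrow> nat \<Rightarrow> bool" where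
  "homog k s H S m \<longleftrightarrow> (\<forall>F\<in>H. settled k s H F \<and> free_pts k s H F = F \<inter> S \<and> card (F \<inter> S) = m)"

text \<open>This certificate survives the passage to subfamilies: no other member contains
  \<open>F - {a}\<close>, so the points of \<open>F \<inter> S\<close> stay free however many
  members are deleted later.\<close>

definition own :: "'a set \<Rightarrow> 'a set set \<Rightarrow> bool" where
  "own S G \<longleftrightarrow> (\<forall>F\<in>G. \<forall>a\<in>F \<inter> S. \<forall>F'\<in>G. F - {a} \<subseteq> F' \<longrightarrow> F' = F)"

text \<open>A kernel \<open>F - {a}\<close> would carry a star with at least
  \<open>s * (k + 1) ^ (k - 1) \<ge> 2\<close> members, but \<open>F\<close> is the only member of
  \<open>G\<close> containing \<open>F - {a}\<close>.\<close>

lemma own_free: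
  assumes G: "own S G" "H \<subseteq> G" "F \<in> G" and k: "card F = k" "k \<ge> 2" "s > 0"
  shows "F \<inter> S \<subseteq> free_pts k s H F"
proof
  fix a assume a: "a \<in> F \<inter> S"
  have "\<not> kern k s H (F - {a})"
  proof
    assume K: "kern k s H (F - {a})"
    have "card (F - {a}) = k - 1" using a k by simp
    moreover have "(k + 1) ^ 1 \<le> (k + 1) ^ (k - 1)" using k by (intro power_increasing) auto
    ultimately have "2 \<le> (k + 1) ^ card (F - {a})" using k by simp
    then have "1 * 2 \<le> s * (k + 1) ^ card (F - {a})" using k(3) by (intro mult_le_mono) auto
    then have "has_star 2 H (F - {a})" using K has_star_le unfolding kern_def by fastforce
    then obtain S2 where S2: "S2 \<subseteq> H" "is_star 2 (F - {a}) S2" unfolding has_star_def by blast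
    then have c: "card S2 = 2" and sub: "\<forall>A\<in>S2. F - {a} \<subset> A" by (simp_all add: is_star_def)
    have "S2 \<subseteq> {F}"
    proof
      fix A assume A: "A \<in> S2"
      then have "A \<in> G" "F - {a} \<subseteq> A" using S2(1) G(2) sub by blast+
      then have "A = F" using G(1,3) a unfolding own_def by blast
      then show "A \<in> {F}" by simp
    qed
    then show False using c card_mono[of "{F}" S2] by simp
  qed
  then show "a \<in> free_pts k s H F" using a unfolding free_pts_def by simp
qed

text \<open>Three restrictions each keep a fixed proportion: to one size \<open>j\<close> of the
  free set (factor \<open>k + 1\<close>), to free sets cut out by one \<open>S\<close> (factor
  \<open>2 ^ k\<close>), and to an independent set of the conflict graph (the last factor).\<close>

lemma exists_own_subfamily:
  assumes G: "unif V k G" and P: "peel_order H R" and k: "k \<ge> 2"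
    and R: "\<And>F. F \<in> R \<Longrightarrow> H F \<subseteq> G \<and> F \<in> G"
    and c: "\<And>F. F \<in> R \<Longrightarrow> card (free_pts k s (H F) F) > m"
  shows "\<exists>I\<subseteq>R. \<exists>S j. j > m \<and> own S I \<and> (\<forall>F\<in>I. card (F \<inter> S) = j) \<and>
    card R \<le> ((k + 1) * (2 ^ k * (k * (s * (k + 1) ^ k) + 1))) * card I"
proof (cases "R = {}")
  case True
  then show ?thesis
    by (intro exI[of _ "{}"] exI[of _ "m+1"] conjI) (simp_all add: own_def)
next
  case False
  let ?B = "\<lambda>F. free_pts k s (H F) F"
  have finR: "finite R" using R unif_finite[OF G] by (meson finite_subset subsetI)
  have mem: "finite F" "card F = k" "F \<subseteq> V" if "F \<in> R" for F using R[OF that] unif_memD[OF G] by blast+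
  have B: "?B F \<subseteq> F" for F unfolding free_pts_def by blast
  have "\<exists>j. card R \<le> (k + 1) * card {F \<in> R. card (?B F) = j}"
  proof (rule ccontr)
    assume "\<not> ?thesis"
    then have lt: "(k + 1) * card {F \<in> R. card (?B F) = j} < card R" for j by (meson not_le)
    have "R \<subseteq> (\<Union>j\<in>{..k}. {F \<in> R. card (?B F) = j})"
      using mem B card_mono by (fastforce intro: card_mono)
    then have "card R \<le> card (\<Union>j\<in>{..k}. {F \<in> R. card (?B F) = j})" using finR by (intro card_mono) auto
    also have "\<dots> \<le> (\<Sum>j\<le>k. card {F \<in> R. card (?B F) = j})" by (rule card_UN_le) simp
    finally have "(k + 1) * card R \<le> (k + 1) * (\<Sum>j\<le>k. card {F \<in> R. card (?B F) = j})"
      by (rule mult_le_mono2)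
    also have "\<dots> = (\<Sum>j\<le>k. (k + 1) * card {F \<in> R. card (?B F) = j})" by (rule sum_distrib_left)
    also have "\<dots> < (\<Sum>j\<le>k. card R)" by (rule sum_strict_mono) (use lt in simp_all)
    finally show False by simp
  qed
  then obtain j where j: "card R \<le> (k + 1) * card {F \<in> R. card (?B F) = j}" by blast
  define R1 where "R1 = {F \<in> R. card (?B F) = j}"
  have "card R > 0" using False finR by (simp add: card_gt_0_iff)
  then have "R1 \<noteq> {}" using j unfolding R1_def[symmetric] by auto
  then have jm: "j > m" using c unfolding R1_def by blast
  have "\<exists>S. card R1 \<le> 2 ^ k * card {F \<in> R1. F \<inter> S = ?B F}"
    by (rule exists_trace_set[of V]) (use G finR mem B in \<open>auto simp: R1_def unif_def\<close>)
  then obtain S where S: "card R1 \<le> 2 ^ k * card {F \<in> R1. F \<inter> S = ?B F}" by blast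
  define R2 where "R2 = {F \<in> R1. F \<inter> S = ?B F}"
  have R2: "F \<in> R" "F \<inter> S = ?B F" "card (F \<inter> S) = j" if "F \<in> R2" for F using that unfolding R2_def R1_def by auto
  \<comment> \<open>A member has few conflicts with those deleted after it, so the conflict graph is degenerate.\<close>
  define E where "E = (\<lambda>F F'. \<exists>a\<in>F \<inter> S. F - {a} \<subseteq> F')"
  \<comment> \<open>Conflicts are symmetric because all traces have the same size: \<open>F\<close>
    arises from \<open>F'\<close> by exchanging the trace point \<open>a\<close> for some
    \<open>b\<close>, so \<open>b\<close> must lie in \<open>S\<close> too.\<close>
  have sym: "E F F'" if FF: "E F' F" "F \<in> R2" "F' \<in> R2" "F \<noteq> F'" for F F'
  proof -
    obtain a where a: "a \<in> F' \<inter> S" "F' - {a} \<subseteq> F" using FF(1) unfolding E_def by blast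
    have f: "finite F" "finite F'" "card F = k" "card F' = k" using mem R2 FF by blast+
    have c1: "card (F' - {a}) = k - 1" using a f by simp
    then have "card (F - (F' - {a})) = 1" using a(2) f k by (simp add: card_Diff_subset)
    then obtain b where b: "F - (F' - {a}) = {b}" by (meson card_1_singletonE)
    have Fe: "F = insert b (F' - {a})" "b \<notin> F' - {a}" using a(2) b by blast+
    have "b \<in> S"
    proof (rule ccontr)
      assume "b \<notin> S"
      then have "F \<inter> S = F' \<inter> S - {a}" using Fe by blast
      then have "card (F \<inter> S) < card (F' \<inter> S)" using a f
        by (metis card_Diff1_less finite_Int)
      then show False using R2 FF by simp
    qed
    then have "b \<in> F \<inter> S" "F - {b} \<subseteq> F'" using Fe by auto
    then show ?thesis unfolding E_def by blast
  qed
  have "\<exists>I\<subseteq>R2. (\<forall>A\<in>I. \<forall>B\<in>I. A \<noteq> B \<longrightarrow> \<not> E A B) \<and> card R2 \<le> (k * (s * (k + 1) ^ k) + 1) * card I"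
  proof (rule degenerate_independent)
    show "finite R2" using finR unfolding R2_def R1_def by simp
    fix Q assume Q: "Q \<subseteq> R2" "Q \<noteq> {}"
    then have "Q \<subseteq> R" using R2 by blast
    then obtain A where A: "A \<in> Q" "Q \<subseteq> H A" using P[unfolded peel_order_def, rule_format, of Q] Q by blast
    have AR: "A \<in> R2" using A(1) Q(1) by blast
    have f: "finite A" "card A = k" using mem R2[OF AR] by blast+
    have "{B \<in> Q. B \<noteq> A \<and> (E A B \<or> E B A)} \<subseteq> (\<Union>a\<in>A \<inter> S. {B \<in> Q. A - {a} \<subseteq> B})"
    proof
      fix B assume "B \<in> {B \<in> Q. B \<noteq> A \<and> (E A B \<or> E B A)}"
      then have "B \<in> Q" "E A B" using sym[of B A] AR Q(1) by blast+
      then show "B \<in> (\<Union>a\<in>A \<inter> S. {B \<in> Q. A - {a} \<subseteq> B})" unfolding E_def by blast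
    qed
    moreover have "finite Q" using \<open>Q \<subseteq> R\<close> finR finite_subset by blast
    ultimately have "card {B \<in> Q. B \<noteq> A \<and> (E A B \<or> E B A)} \<le> card (\<Union>a\<in>A \<inter> S. {B \<in> Q. A - {a} \<subseteq> B})"
      using f by (intro card_mono) auto
    also have "\<dots> \<le> card (A \<inter> S) * (s * (k + 1) ^ k)"
    proof (rule card_UN_le_mult)
      show "finite (A \<inter> S)" using f by simp
      fix a assume a: "a \<in> A \<inter> S"
      then have "a \<in> ?B A" using R2[OF AR] by blast
      then have "\<not> has_star (s * (k + 1) ^ card (A - {a})) (H A) (A - {a})"
        unfolding free_pts_def kern_def by blast
      moreover have "unif V k (H A)" using unif_subset[OF G] R[OF R2(1)[OF AR]] by simp
      moreover have c1: "Suc (card (A - {a})) = k" using a f card_Suc_Diff1 by fastforce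
      moreover have "finite (A - {a})" using f by simp
      moreover have "{B \<in> Q. A - {a} \<subseteq> B} \<subseteq> H A" using A(2) by blast
      ultimately have "card {B \<in> Q. A - {a} \<subseteq> B} < s * (k + 1) ^ card (A - {a})"
        by (intro codim1_star[of V k "H A" "A - {a}"]) simp_all
      then show "card {B \<in> Q. A - {a} \<subseteq> B} \<le> s * (k + 1) ^ k"
        using c1 pow_bound[of "card (A - {a})" k s] by linarith
    qed
    also have "\<dots> \<le> k * (s * (k + 1) ^ k)" using f card_mono[of A "A \<inter> S"] by (intro mult_le_mono1) auto
    finally show "\<exists>A\<in>Q. card {B \<in> Q. B \<noteq> A \<and> (E A B \<or> E B A)} \<le> k * (s * (k + 1) ^ k)"
      using A(1) by blast
  qed
  then obtain I where I: "I \<subseteq> R2" "\<forall>A\<in>I. \<forall>B\<in>I. A \<noteq> B \<longrightarrow> \<not> E A B"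
    "card R2 \<le> (k * (s * (k + 1) ^ k) + 1) * card I" by blast
  have "own S I" using I(2) unfolding own_def E_def by blast
  moreover have "\<forall>F\<in>I. card (F \<inter> S) = j" using I(1) R2 by blast
  moreover have "I \<subseteq> R" using I(1) R2 by blast
  moreover have "card R \<le> ((k + 1) * (2 ^ k * (k * (s * (k + 1) ^ k) + 1))) * card I"
  proof -
    have "card R \<le> (k + 1) * card R1" using j unfolding R1_def .
    also have "\<dots> \<le> (k + 1) * (2 ^ k * card R2)" using S unfolding R2_def by (rule mult_le_mono2)
    also have "\<dots> \<le> (k + 1) * (2 ^ k * ((k * (s * (k + 1) ^ k) + 1) * card I))" using I(3) by (intro mult_le_mono2)
    finally show ?thesis by (simp only: mult.assoc)
  qed
  ultimately show ?thesis using jm by blast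
qed

text \<open>Induction on \<open>d\<close>, which limits how often the trace size \<open>m\<close>
  can still grow; \<open>m > k\<close> is impossible for traces of \<open>k\<close>-sets. If the
  deletion process exhausts \<open>G\<close>, few members fall to defects, so many fall because they
  have free points outside \<open>S\<close>. These yield a proportional subfamily with larger
  traces.\<close>

lemma homog_subfamily_aux:
  assumes k: "k \<ge> 2" and s: "s > 0"
  shows "\<exists>C. \<forall>(V::'a set) G S m. unif V k G \<and> own S G \<and> (\<forall>F\<in>G. card (F \<inter> S) = m) \<and> k < m + d \<and>
    C * (card V choose (k - 2)) < card G \<longrightarrow> (\<exists>H\<subseteq>G. H \<noteq> {} \<and> (\<exists>S m. homog k s H S m))"
proof (induction d)
  case 0
  show ?case
  proof (intro exI[of _ 0] allI impI)
    fix V :: "'a set" and G S m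
    assume a: "unif V k G \<and> own S G \<and> (\<forall>F\<in>G. card (F \<inter> S) = m) \<and> k < m + 0 \<and>
      0 * (card V choose (k - 2)) < card G"
    then have "G \<noteq> {}" by auto
    then obtain F where F: "F \<in> G" by blast
    have "finite F" "card F = k" using unif_memD[of V k G F] a F by auto
    then have "card (F \<inter> S) \<le> k" using card_mono[of F "F \<inter> S"] by auto
    then show "\<exists>H\<subseteq>G. H \<noteq> {} \<and> (\<exists>S m. homog k s H S m)" using a F by auto
  qed
next
  case (Suc d)
  obtain C where C: "\<forall>(V::'a set) G S m. unif V k G \<and> own S G \<and> (\<forall>F\<in>G. card (F \<inter> S) = m) \<and> k < m + d \<and>
    C * (card V choose (k - 2)) < card G \<longrightarrow> (\<exists>H\<subseteq>G. H \<noteq> {} \<and> (\<exists>S m. homog k s H S m))"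
    using Suc by (rule exE)
  let ?C1 = "2 ^ (k - 2) * (k * (s * (k + 1) ^ k))\<^sup>2"
  let ?C2 = "k * (s * (k + 1) ^ k) * (s * (k + 1) ^ k)"
  let ?L = "(k + 1) * (2 ^ k * (k * (s * (k + 1) ^ k) + 1))"
  show ?case
  \<comment> \<open>\<open>?C1\<close> and \<open>?C2\<close> pay for the meet and cover defects.
    The factor \<open>?L\<close> is the loss in passing to an owned subfamily, to which the constant
    \<open>C\<close> of the induction hypothesis applies.\<close>
  proof (intro exI[of _ "?C1 + ?C2 + ?L * C"] allI impI)
    fix V :: "'a set" and G S m
    assume a: "unif V k G \<and> own S G \<and> (\<forall>F\<in>G. card (F \<inter> S) = m) \<and> k < m + Suc d \<and>
      (?C1 + ?C2 + ?L * C) * (card V choose (k - 2)) < card G"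
    let ?N = "card V choose (k - 2)"
    have G: "unif V k G" using a by (rule conjunct1)
    note a = a[THEN conjunct2]
    have O: "own S G" using a by (rule conjunct1)
    note a = a[THEN conjunct2]
    have m: "card (F \<inter> S) = m" if "F \<in> G" for F using a[THEN conjunct1] that by (rule bspec)
    note a = a[THEN conjunct2]
    have d: "k < m + Suc d" using a by (rule conjunct1)
    have big: "(?C1 + ?C2 + ?L * C) * ?N < card G" using a by (rule conjunct2)
    have finG: "finite G" using unif_finite[OF G] .
    define bad where "bad = (\<lambda>G A. \<not> settled k s G A \<or> free_pts k s G A \<noteq> A \<inter> S)"
    obtain Gs H where Gs: "Gs \<subseteq> G" "\<forall>A\<in>Gs. \<not> bad Gs A"
      and H: "\<forall>A\<in>G - Gs. bad (H A) A \<and> H A \<subseteq> G" "peel_order H (G - Gs)"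
      using peeling[OF finG, of bad] by blast
    show "\<exists>H\<subseteq>G. H \<noteq> {} \<and> (\<exists>S m. homog k s H S m)"
    proof (cases "Gs = {}")
      case False
      have "homog k s Gs S m" unfolding homog_def using Gs m unfolding bad_def by auto
      then show ?thesis using Gs(1) False by blast
    next
      case True
      then have HG: "H F \<subseteq> G" "\<not> settled k s (H F) F \<or> free_pts k s (H F) F \<noteq> F \<inter> S" if "F \<in> G" for F
        using H(1) that unfolding bad_def by auto
      have P: "peel_order H G" using H(2) True by simp
      define R1 where "R1 = {F \<in> G. \<exists>D. meet_defect k s (H F) F D}"
      define R2 where "R2 = {F \<in> G. \<exists>D. cover_defect k s (H F) F D}"
      define R3 where "R3 = {F \<in> G. free_pts k s (H F) F \<noteq> F \<inter> S}"
      have "G \<subseteq> R1 \<union> R2 \<union> R3" using HG(2) unfolding R1_def R2_def R3_def settled_def by blast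
      then have "card G \<le> card (R1 \<union> R2 \<union> R3)" using finG unfolding R1_def R2_def R3_def by (intro card_mono) auto
      also have "\<dots> \<le> card (R1 \<union> R2) + card R3" by (rule card_Un_le)
      also have "card (R1 \<union> R2) \<le> card R1 + card R2" by (rule card_Un_le)
      also have "card R1 \<le> ?N * ?C1"
        by (rule meet_defect_count[OF G peel_order_subset[OF P] s]) (use HG in \<open>auto simp: R1_def\<close>)
      also have "card R2 \<le> ?N * ?C2"
        by (rule cover_defect_count[OF G peel_order_subset[OF P]]) (use HG in \<open>auto simp: R2_def\<close>)
      finally have 1: "card G \<le> ?N * ?C1 + ?N * ?C2 + card R3" by simp
      have R3: "H F \<subseteq> G \<and> F \<in> G" if "F \<in> R3" for F using HG that unfolding R3_def by blast
      have free: "card (free_pts k s (H F) F) > m" if F: "F \<in> R3" for F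
      proof -
        have f: "finite F" "card F = k" using unif_memD[OF G] R3[OF F] by blast+
        have "F \<inter> S \<subseteq> free_pts k s (H F) F" using own_free[OF O _ _ f(2) k s] R3[OF F] by blast
        moreover have "free_pts k s (H F) F \<noteq> F \<inter> S" using F unfolding R3_def by blast
        moreover have "finite (free_pts k s (H F) F)" using f(1) unfolding free_pts_def by simp
        ultimately have "card (F \<inter> S) < card (free_pts k s (H F) F)" by (intro psubset_card_mono) auto
        then show ?thesis using m R3[OF F] by simp
      qed
      have "R3 \<subseteq> G" unfolding R3_def by (rule Collect_restrict)
      then have P3: "peel_order H R3" by (rule peel_order_subset[OF P])
      have "\<exists>I\<subseteq>R3. \<exists>S j. j > m \<and> own S I \<and> (\<forall>F\<in>I. card (F \<inter> S) = j) \<and> card R3 \<le> ?L * card I"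
        by (rule exists_own_subfamily[OF G P3 k]) (use R3 free in simp_all)
      then obtain I S' j where I: "I \<subseteq> R3" "j > m" "own S' I" "\<forall>F\<in>I. card (F \<inter> S') = j"
        "card R3 \<le> ?L * card I"
        by (elim exE conjE) (rule that)
      have IG: "I \<subseteq> G" using I(1) unfolding R3_def by blast
      have "C * ?N < card I"
      proof (rule ccontr)
        assume "\<not> ?thesis"
        then have "card I \<le> C * ?N" by simp
        then have "?L * card I \<le> ?L * (C * ?N)" by (rule mult_le_mono2)
        then have "card R3 \<le> ?L * C * ?N" using I(5) by (simp only: mult.assoc le_trans)
        then have "card G \<le> ?N * ?C1 + ?N * ?C2 + ?L * C * ?N" using 1 by linarith
        also have "\<dots> = (?C1 + ?C2 + ?L * C) * ?N" by (simp only: distrib_right mult.commute[of ?N])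
        finally show False using big by simp
      qed
      moreover have "k < j + d" using d I(2) by simp
      ultimately obtain H' where "H' \<subseteq> I" "H' \<noteq> {}" "\<exists>S m. homog k s H' S m"
        using C[rule_format, of V I S' j] unif_subset[OF G IG] I(3,4) by auto
      then show ?thesis using IG by blast
    qed
  qed
qed

lemma homog_subfamily:
  assumes "k \<ge> 2" "s > 0"
  shows "\<exists>C. \<forall>(V::'a set) G. unif V k G \<and> C * (card V choose (k - 2)) < card G \<longrightarrow>
    (\<exists>H\<subseteq>G. H \<noteq> {} \<and> (\<exists>S m. homog k s H S m))"
proof -
  \<comment> \<open>The search starts from the empty trace, \<open>S = {}\<close> and
    \<open>m = 0\<close>, where ownership is vacuous; \<open>d = Suc k\<close> then satisfies
    \<open>k < m + d\<close>.\<close>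
  obtain C where C: "\<forall>(V::'a set) G S m. unif V k G \<and> own S G \<and> (\<forall>F\<in>G. card (F \<inter> S) = m) \<and> k < m + Suc k \<and>
    C * (card V choose (k - 2)) < card G \<longrightarrow> (\<exists>H\<subseteq>G. H \<noteq> {} \<and> (\<exists>S m. homog k s H S m))"
    using homog_subfamily_aux[OF assms, of "Suc k"] by (rule exE)
  have own: "own {} G" for G :: "'a set set" unfolding own_def by simp
  show ?thesis
  proof (intro exI[of _ C] allI impI)
    fix V :: "'a set" and G
    assume "unif V k G \<and> C * (card V choose (k - 2)) < card G"
    then show "\<exists>H\<subseteq>G. H \<noteq> {} \<and> (\<exists>S m. homog k s H S m)"
      using own[of G] by (intro C[rule_format, of V G "{}" 0]) simp
  qed
qed

subsection \<open>Cycles\<close>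

lemma card_Int_Diff_split: "finite F \<Longrightarrow> D \<subseteq> F \<Longrightarrow> card (F \<inter> S) = card (D \<inter> S) + card ((F - D) \<inter> S)"
  by (subst card_Un_disjoint[symmetric]) (auto intro: finite_subset arg_cong[where f = card])

lemma successively_nth:
  assumes "successively P xs" "Suc i < length xs"
  shows "P (xs ! i) (xs ! Suc i)"
  using assms by (simp add: successively_conv_nth)

lemma successively_cycle_nth:
  assumes "successively P (xs @ [hd xs])" "i < length xs"
  shows "P (xs ! i) (xs ! (Suc i mod length xs))"
proof (cases "Suc i = length xs")
  case True
  have "P ((xs @ [hd xs]) ! i) ((xs @ [hd xs]) ! Suc i)" by (rule successively_nth[OF assms(1)]) (use assms(2) in simp)
  moreover have "xs \<noteq> []" using assms(2) by auto
  moreover have "Suc i mod length xs = 0" using True by simp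
  ultimately show ?thesis using True assms(2) by (simp add: nth_append hd_conv_nth)
next
  case False
  have "P ((xs @ [hd xs]) ! i) ((xs @ [hd xs]) ! Suc i)" by (rule successively_nth[OF assms(1)]) (use assms(2) in simp)
  moreover have "Suc i mod length xs = Suc i" using False assms(2) by simp
  ultimately show ?thesis using False assms(2) by (simp add: nth_append)
qed

text \<open>Abstracts what the cycle constructions use of a homogeneous subfamily: its members have traces of
  equal size \<open>m\<close> on \<open>S\<close>, and \<open>D \<subset> F\<close> carries a large star unless it misses exactly one point of \<open>F \<inter> S\<close>.\<close>

locale traced =
  fixes H :: "'a set set" and S :: "'a set" and k s m :: nat
  assumes mem: "F \<in> H \<Longrightarrow> finite F" "F \<in> H \<Longrightarrow> card F = k" "F \<in> H \<Longrightarrow> card (F \<inter> S) = m"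
    and star: "F \<in> H \<Longrightarrow> D \<subset> F \<Longrightarrow> card ((F - D) \<inter> S) \<noteq> 1 \<Longrightarrow> has_star s H D"
begin

section \<open>The graph of kernel pairs\<close>

definition adj :: "'a \<Rightarrow> 'a \<Rightarrow> bool" where
  "adj x y \<longleftrightarrow> has_star s H {x, y}"

lemma adj_commute: "adj x y \<longleftrightarrow> adj y x"
  by (simp add: adj_def insert_commute)

text \<open>Exchange \<open>F\<close> for a member \<open>F'\<close> of the star at \<open>D\<close>
  that avoids \<open>X\<close> outside \<open>D\<close>. Since sizes and trace sizes are constant on
  \<open>H\<close>, \<open>F' - D\<close> has as many points in \<open>S\<close> and outside
  \<open>S\<close> as \<open>F - D\<close>, so \<open>v\<close> has a fresh counterpart of the same
  kind.\<close>

lemma replace_vertex: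
  assumes F: "F \<in> H" "D \<subset> F" "card ((F - D) \<inter> S) \<noteq> 1" and X: "finite X" "card X < s" and v: "v \<in> F - D"
  obtains F' v' where "F' \<in> H" "D \<subset> F'" "F' \<inter> X \<subseteq> D" "v' \<in> F' - D" "v' \<in> S \<longleftrightarrow> v \<in> S"
    "card ((F' - D) \<inter> S) = card ((F - D) \<inter> S)" "card (F' - D) = card (F - D)"
proof -
  obtain F' where F': "F' \<in> H" "D \<subset> F'" "F' \<inter> X \<subseteq> D"
    using star_avoiding[OF star[OF F] X] by blast
  have sub: "D \<subseteq> F" "D \<subseteq> F'" using F(2) F'(2) by auto
  have fin: "finite F" "finite F'" "finite D" using mem(1) F(1) F'(1) sub finite_subset by blast+
  have c1: "card ((F' - D) \<inter> S) = card ((F - D) \<inter> S)"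
    using card_Int_Diff_split[OF fin(1) sub(1), of S] card_Int_Diff_split[OF fin(2) sub(2), of S]
      mem(3)[OF F(1)] mem(3)[OF F'(1)] by simp
  have c2: "card (F' - D) = card (F - D)"
    using mem(2)[OF F(1)] mem(2)[OF F'(1)] fin sub by (simp add: card_Diff_subset)
  have d1: "card (F - D) = card ((F - D) \<inter> S) + card (F - D - S)"
    using fin by (subst card_Un_disjoint[symmetric]) (auto intro: arg_cong[where f = card])
  have d2: "card (F' - D) = card ((F' - D) \<inter> S) + card (F' - D - S)"
    using fin by (subst card_Un_disjoint[symmetric]) (auto intro: arg_cong[where f = card])
  have "\<exists>v'. v' \<in> F' - D \<and> (v' \<in> S \<longleftrightarrow> v \<in> S)"
  proof (cases "v \<in> S")
    case True
    then have "(F - D) \<inter> S \<noteq> {}" using v by blast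
    then have "card ((F' - D) \<inter> S) \<noteq> 0" using c1 fin by simp
    then have "(F' - D) \<inter> S \<noteq> {}" by (metis card.empty)
    then show ?thesis using True by blast
  next
    case False
    then have "F - D - S \<noteq> {}" using v by blast
    then have "card (F - D - S) \<noteq> 0" using fin by simp
    then have "card (F' - D - S) \<noteq> 0" using c1 c2 d1 d2 by linarith
    then have "F' - D - S \<noteq> {}" by (metis card.empty)
    then show ?thesis using False by blast
  qed
  then show ?thesis using that F' c1 c2 by blast
qed

text \<open>The bound on \<open>m\<close> says that the pair misses at least two points of the
  trace.\<close>

lemma adjI:
  assumes "F \<in> H" "x \<in> F" "y \<in> F" "k \<ge> 3" "m \<ge> 2 + card ({x, y} \<inter> S)"
  shows "adj x y"
  unfolding adj_def
proof (rule star[OF assms(1)])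
  have fin: "finite F" using mem(1) assms(1) by blast
  have "card {x, y} < card F" using assms mem(2) card_insert_le_m1[of 2 "{y}" x] by fastforce
  then show "{x, y} \<subset> F" using assms(2,3) by auto
  have "card (F \<inter> S) = card ({x, y} \<inter> S) + card ((F - {x, y}) \<inter> S)"
    using assms(2,3) fin by (intro card_Int_Diff_split) auto
  then show "card ((F - {x, y}) \<inter> S) \<noteq> 1" using mem(3)[OF assms(1)] assms(5) by linarith
qed

lemma triangle_adjI:
  assumes "F \<in> H" "t \<subseteq> F" "x \<in> t" "y \<in> t" "card (t \<inter> S) = r" "m \<ge> 2 + min 2 r" "k \<ge> 3"
  shows "adj x y"
proof (rule adjI[OF assms(1)])
  have fin: "finite t" using mem(1) assms(1,2) finite_subset by blast
  have "card ({x, y} \<inter> S) \<le> card (t \<inter> S)" using fin assms(3,4) by (intro card_mono) auto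
  moreover have "card ({x, y} \<inter> S) \<le> card {x, y}" by (intro card_mono) auto
  moreover have "card {x, y} \<le> 2" by (simp add: card_insert_if)
  ultimately show "m \<ge> 2 + card ({x, y} \<inter> S)" using assms(5,6) by linarith
qed (use assms in auto)

text \<open>The invariant is a cycle with three consecutive vertices \<open>x, z, y\<close> in one
  member. Exchanging \<open>y\<close> for a fresh \<open>v\<close> while keeping \<open>x\<close>
  and \<open>z\<close> gives a triangle \<open>x, v, z\<close>, and inserting \<open>v\<close>
  between \<open>x\<close> and \<open>z\<close> lengthens the cycle by one.\<close>

lemma triangle_cycle:
  assumes F0: "F0 \<in> H" "t0 \<subseteq> F0" "card t0 = 3" "card (t0 \<inter> S) = r" and m: "m \<ge> 2 + min 2 r" and k: "k \<ge> 3"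
    and n: "n + 3 \<le> s"
  shows "\<exists>x z y rest F. F \<in> H \<and> {x, y, z} \<subseteq> F \<and> distinct (x # z # y # rest) \<and> card ({x, y, z} \<inter> S) = r \<and>
    successively adj (x # z # y # rest @ [x]) \<and> length rest = n"
  using n
proof (induction n)
  case 0
  obtain x y z where t: "t0 = {x, y, z}" "x \<noteq> y" "x \<noteq> z" "y \<noteq> z" using F0(3) by (auto simp: card_3_iff)
  have "adj a b" if "a \<in> t0" "b \<in> t0" for a b by (rule triangle_adjI[OF F0(1,2) that F0(4) m k])
  then have "successively adj (x # z # y # [] @ [x])" using t(1) by simp
  then show ?case using F0 t by (intro exI[of _ x] exI[of _ z] exI[of _ y] exI[of _ "[]"] exI[of _ F0]) simp
next
  case (Suc n)
  then obtain x z y rest F where F: "F \<in> H" "{x, y, z} \<subseteq> F" "distinct (x # z # y # rest)"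
    "card ({x, y, z} \<inter> S) = r" "successively adj (x # z # y # rest @ [x])" "length rest = n" by auto
  have finF: "finite F" using mem(1) F(1) by blast
  \<comment> \<open>If \<open>y\<close> is in \<open>S\<close>, dropping \<open>y\<close> alone
    would miss exactly one trace point. A second trace point \<open>b\<close> outside the triangle
    is dropped with it; it exists because \<open>m > r\<close>.\<close>
  have "\<exists>D\<subset>F. card ((F - D) \<inter> S) \<noteq> 1 \<and> y \<notin> D \<and> x \<in> D \<and> z \<in> D"
  proof (cases "y \<in> S")
    case False
    then have "(F - (F - {y})) \<inter> S = {}" by blast
    then have "card ((F - (F - {y})) \<inter> S) \<noteq> 1" by (metis card.empty zero_neq_one)
    moreover have "F - {y} \<subset> F" using F(2) by blast
    ultimately show ?thesis using F(2,3) by (intro exI[of _ "F - {y}"]) auto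
  next
    case True
    have "r \<le> 3" using F(4) card_mono[of "{x, y, z}" "{x, y, z} \<inter> S"] card_insert_le_m1[of 3 "{y, z}" x]
      by (auto simp: card_insert_if split: if_splits)
    then have "card ({x, y, z} \<inter> S) < card (F \<inter> S)" using F(1,4) mem(3) m by simp
    then have "\<not> F \<inter> S \<subseteq> {x, y, z} \<inter> S" using card_mono[of "{x, y, z} \<inter> S" "F \<inter> S"] by auto
    then obtain b where b: "b \<in> F" "b \<in> S" "b \<notin> {x, y, z}" by blast
    have "(F - (F - {y, b})) \<inter> S = {y, b}" using b True F(2) by blast
    then have "card ((F - (F - {y, b})) \<inter> S) = 2" using b(3) by (metis card_2_iff insert_iff)
    moreover have "F - {y, b} \<subset> F" using F(2) by blast
    ultimately show ?thesis using F(2,3) b(3) by (intro exI[of _ "F - {y, b}"]) auto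
  qed
  then obtain D where D: "D \<subset> F" "card ((F - D) \<inter> S) \<noteq> 1" "y \<notin> D" "x \<in> D" "z \<in> D" by blast
  let ?xs = "x # z # y # rest"
  have cs: "card (set ?xs) < s" using distinct_card[OF F(3)] F(6) Suc.prems by simp
  have yD: "y \<in> F - D" using D F(2) by blast
  obtain F' v where F': "F' \<in> H" "D \<subset> F'" "F' \<inter> set ?xs \<subseteq> D" "v \<in> F' - D" "v \<in> S \<longleftrightarrow> y \<in> S"
    by (rule replace_vertex[OF F(1) D(1,2) finite_set cs yD])
  have v: "v \<notin> set ?xs" using F'(3,4) by blast
  have "{x, z, v} \<subseteq> F'" using F'(2,4) D by auto
  have c: "card ({x, z, v} \<inter> S) = card ({x, y, z} \<inter> S)"
    using v F(3) F'(5) by (cases "x \<in> S"; cases "z \<in> S"; cases "y \<in> S") (auto simp: Int_insert_left)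
  have "adj a b" if "a \<in> {x, z, v}" "b \<in> {x, z, v}" for a b
    by (rule triangle_adjI[OF F'(1) \<open>{x, z, v} \<subseteq> F'\<close> that _ m k]) (use c F(4) in simp)
  then have "successively adj (x # v # z # (y # rest) @ [x])" using F(5) by simp
  moreover have "distinct (x # v # z # (y # rest))" using v F(3) by auto
  moreover have "length (y # rest) = Suc n" using F(6) by simp
  moreover have "{x, z, v} \<subseteq> F' \<and> card ({x, z, v} \<inter> S) = r" using c F(4) \<open>{x, z, v} \<subseteq> F'\<close> by simp
  ultimately show ?case using F'(1) by blast
qed

section \<open>Cycles of sets from cycles of kernels\<close>

text \<open>The sets are chosen one by one, each avoiding, outside its own kernel, all sets already
  chosen and all kernels still to be expanded. Together these have at most
  \<open>k * (l - 1) < s\<close> points.\<close>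

lemma expand_stars:
  assumes D: "\<And>i. i < l \<Longrightarrow> has_star s H (D i)" and s: "k * l \<le> s" "k > 0"
  shows "\<exists>Fs. \<forall>i<l. Fs i \<in> H \<and> D i \<subset> Fs i \<and> (\<forall>j<l. j \<noteq> i \<longrightarrow> Fs i \<inter> Fs j = D i \<inter> D j)"
proof -
  have cD: "finite (D i) \<and> card (D i) \<le> k" if i: "i < l" for i
  proof -
    have "k * 1 \<le> k * l" using i by (intro mult_le_mono2) simp
    then have "card ({}::'a set) < s" using s unfolding card.empty by linarith
    then obtain A where "A \<in> H" "D i \<subset> A" using star_avoiding[OF D[OF i], of "{}"] by blast
    then show ?thesis using mem(1,2) by (metis card_mono finite_subset psubset_imp_subset)
  qed
  have "\<exists>Fs. \<forall>i<n. Fs i \<in> H \<and> D i \<subset> Fs i \<and> (\<forall>j<l. j \<noteq> i \<longrightarrow> Fs i \<inter> D j \<subseteq> D i) \<and>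
      (\<forall>j<n. j \<noteq> i \<longrightarrow> Fs i \<inter> Fs j = D i \<inter> D j)" if "n \<le> l" for n
    using that
  proof (induction n)
    case 0
    show ?case by simp
  next
    case (Suc n)
    from Suc.IH[OF Suc_leD[OF Suc.prems]] obtain Fs where
      Fs0: "\<forall>i<n. Fs i \<in> H \<and> D i \<subset> Fs i \<and> (\<forall>j<l. j \<noteq> i \<longrightarrow> Fs i \<inter> D j \<subseteq> D i) \<and>
      (\<forall>j<n. j \<noteq> i \<longrightarrow> Fs i \<inter> Fs j = D i \<inter> D j)" by (rule exE)
    then have Fs: "\<And>i. i < n \<Longrightarrow> Fs i \<in> H" "\<And>i. i < n \<Longrightarrow> D i \<subset> Fs i"
      "\<And>i j. i < n \<Longrightarrow> j < l \<Longrightarrow> j \<noteq> i \<Longrightarrow> Fs i \<inter> D j \<subseteq> D i"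
      "\<And>i j. i < n \<Longrightarrow> j < n \<Longrightarrow> j \<noteq> i \<Longrightarrow> Fs i \<inter> Fs j = D i \<inter> D j" by simp_all
    \<comment> \<open>Avoiding \<open>Fs j\<close> for \<open>j < n\<close> also avoids
      \<open>D j\<close>, since \<open>D j \<subset> Fs j\<close>, so the invariant for kernels
      persists.\<close>
    let ?g = "\<lambda>j. if j < n then Fs j else D j"
    let ?X = "\<Union>j\<in>{..<l} - {n}. ?g j"
    have g: "finite (?g j) \<and> card (?g j) \<le> k" if "j < l" for j using cD[OF that] Fs(1)[of j] mem(1,2) by auto
    then have finX: "finite ?X" by blast
    have "card ?X \<le> card ({..<l} - {n}) * k" by (rule card_UN_le_mult) (use g in auto)
    also have "\<dots> = (l - 1) * k" using Suc.prems by simp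
    also have "\<dots> < k * l" using s(2) Suc.prems by (cases l) auto
    finally have cX: "card ?X < s" using s(1) by linarith
    have "n < l" using Suc.prems by simp
    from star_avoiding[OF D[OF this] finX cX] obtain A where A: "A \<in> H" "D n \<subset> A" "A \<inter> ?X \<subseteq> D n"
      by blast
    have AX: "A \<inter> ?g j \<subseteq> D n" if "j < l" "j \<noteq> n" for j using A(3) that by blast
    have AF: "A \<inter> Fs j = D n \<inter> D j" if j: "j < n" for j
    proof -
      have "A \<inter> Fs j \<subseteq> D n" using AX[of j] j Suc.prems by simp
      moreover have "Fs j \<inter> D n \<subseteq> D j" using Fs(3)[of j n] j Suc.prems by simp
      ultimately show ?thesis using A(2) Fs(2)[OF j] by blast
    qed
    have AD: "A \<inter> D j \<subseteq> D n" if "j < l" "j \<noteq> n" for j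
      using AX[OF that] Fs(2)[of j] by (cases "j < n") auto
    show ?case
    proof (intro exI[of _ "Fs(n := A)"] allI impI)
      fix i assume i: "i < Suc n"
      show "(Fs(n := A)) i \<in> H \<and> D i \<subset> (Fs(n := A)) i \<and> (\<forall>j<l. j \<noteq> i \<longrightarrow> (Fs(n := A)) i \<inter> D j \<subseteq> D i) \<and>
        (\<forall>j<Suc n. j \<noteq> i \<longrightarrow> (Fs(n := A)) i \<inter> (Fs(n := A)) j = D i \<inter> D j)"
      proof (cases "i = n")
        case True
        have "(Fs(n := A)) i \<inter> (Fs(n := A)) j = D i \<inter> D j" if "j < Suc n" "j \<noteq> i" for j
          using that True AF[of j] by simp
        then show ?thesis using True A(1,2) AD by simp
      next
        case False
        then have i': "i < n" using i by simp
        have "(Fs(n := A)) i \<inter> (Fs(n := A)) j = D i \<inter> D j" if "j < Suc n" "j \<noteq> i" for j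
          using that False AF[of i] i' Fs(4)[of i j] by (cases "j = n") auto
        then show ?thesis using False Fs(1,2,3)[OF i'] by simp
      qed
    qed
  qed
  from this[of l, OF order_refl] obtain Fs where
    "\<forall>i<l. Fs i \<in> H \<and> D i \<subset> Fs i \<and> (\<forall>j<l. j \<noteq> i \<longrightarrow> Fs i \<inter> D j \<subseteq> D i) \<and>
      (\<forall>j<l. j \<noteq> i \<longrightarrow> Fs i \<inter> Fs j = D i \<inter> D j)" by (rule exE)
  then show ?thesis by (intro exI[of _ Fs]) simp
qed

text \<open>Expansion creates no new intersections, so a cycle vertex in \<open>Fs i\<close> already
  lies in the edge \<open>?D i\<close>, and two expanded edges share only cycle vertices.\<close>

lemma linear_cycle:
  assumes vs: "distinct vs" "length vs = l" and D: "\<And>i. i < l \<Longrightarrow> adj (vs ! i) (vs ! (Suc i mod l))"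
    and s: "k * l \<le> s" "k > 0"
  shows "\<exists>C\<in>linear_cycles k l. C \<subseteq> H"
proof -
  let ?D = "\<lambda>i. {vs ! i, vs ! (Suc i mod l)}"
  have "\<exists>Fs. \<forall>i<l. Fs i \<in> H \<and> ?D i \<subset> Fs i \<and> (\<forall>j<l. j \<noteq> i \<longrightarrow> Fs i \<inter> Fs j = ?D i \<inter> ?D j)"
    by (rule expand_stars[OF _ s]) (use D in \<open>simp add: adj_def\<close>)
  then obtain Fs where
    F0: "\<forall>i<l. Fs i \<in> H \<and> ?D i \<subset> Fs i \<and> (\<forall>j<l. j \<noteq> i \<longrightarrow> Fs i \<inter> Fs j = ?D i \<inter> ?D j)" by (rule exE)
  have Fs: "Fs i \<in> H" "?D i \<subset> Fs i" "j < l \<Longrightarrow> j \<noteq> i \<Longrightarrow> Fs i \<inter> Fs j = ?D i \<inter> ?D j" if "i < l" for i j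
    by (rule F0[rule_format, OF that, THEN conjunct1],
        rule F0[rule_format, OF that, THEN conjunct2, THEN conjunct1],
        rule F0[rule_format, OF that, THEN conjunct2, THEN conjunct2, rule_format])
  let ?V = "(!) vs ` {..<l}"
  have DV: "?D i \<subseteq> ?V" if "i < l" for i using that by auto
  have inj: "inj_on ((!) vs) {..<l}" using vs by (auto simp: inj_on_def nth_eq_iff_index_eq)
  have "Fs ` {..<l} \<in> linear_cycles k l"
    unfolding linear_cycles_def
  proof (intro CollectI exI[of _ Fs] exI[of _ "(!) vs"] conjI allI impI)
    fix i assume i: "i < l"
    show "finite (Fs i)" "card (Fs i) = k" using mem(1,2) Fs(1)[OF i] by blast+
    show "Fs i \<inter> ?V = ?D i"
    proof
      show "?D i \<subseteq> Fs i \<inter> ?V" using Fs(2)[OF i] DV[OF i] by blast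
      show "Fs i \<inter> ?V \<subseteq> ?D i"
      proof
        fix x assume x: "x \<in> Fs i \<inter> ?V"
        then obtain j where j: "j < l" "x = vs ! j" by blast
        show "x \<in> ?D i"
        proof (cases "j = i")
          case False
          have "x \<in> Fs j" using Fs(2)[OF j(1)] j(2) by blast
          then have "x \<in> ?D i \<inter> ?D j" using Fs(3)[OF i j(1) False] x by blast
          then show ?thesis by blast
        qed (use j in simp)
      qed
    qed
  next
    fix i j assume ij: "i < l" "j < l" "i \<noteq> j"
    then have "Fs i \<inter> Fs j = ?D i \<inter> ?D j" using Fs(3)[of i j] by simp
    then show "(Fs i - ?V) \<inter> (Fs j - ?V) = {}" using DV[OF ij(1)] by blast
  qed (use inj in simp_all)
  moreover have "Fs ` {..<l} \<subseteq> H" using Fs(1) by blast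
  ultimately show ?thesis by blast
qed

text \<open>The last \<open>q\<close> edges of the cycle may share the extra vertex \<open>e\<close>; with \<open>q \<le> 2\<close> they are consecutive.\<close>

lemma minimal_cycle:
  assumes vs: "distinct vs" "length vs = l" "q \<noteq> 0 \<Longrightarrow> e \<notin> set vs" and q: "q \<le> 2"
    and D: "\<And>i. i < l \<Longrightarrow> has_star s H ({vs ! i, vs ! (Suc i mod l)} \<union> (if l \<le> i + q then {e} else {}))"
    and s: "k * l \<le> s" "k > 0"
  shows "\<exists>C\<in>minimal_cycles k l. C \<subseteq> H"
proof -
  let ?D = "\<lambda>i. {vs ! i, vs ! (Suc i mod l)} \<union> (if l \<le> i + q then {e} else {})"
  have "\<exists>Fs. \<forall>i<l. Fs i \<in> H \<and> ?D i \<subset> Fs i \<and> (\<forall>j<l. j \<noteq> i \<longrightarrow> Fs i \<inter> Fs j = ?D i \<inter> ?D j)"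
    by (rule expand_stars[OF D s])
  then obtain Fs where
    F0: "\<forall>i<l. Fs i \<in> H \<and> ?D i \<subset> Fs i \<and> (\<forall>j<l. j \<noteq> i \<longrightarrow> Fs i \<inter> Fs j = ?D i \<inter> ?D j)" by (rule exE)
  have Fs: "Fs i \<in> H" "?D i \<subset> Fs i" "j < l \<Longrightarrow> j \<noteq> i \<Longrightarrow> Fs i \<inter> Fs j = ?D i \<inter> ?D j" if "i < l" for i j
    by (rule F0[rule_format, OF that, THEN conjunct1],
        rule F0[rule_format, OF that, THEN conjunct2, THEN conjunct1],
        rule F0[rule_format, OF that, THEN conjunct2, THEN conjunct2, rule_format])
  have inj: "inj_on ((!) vs) {..<l}" using vs by (auto simp: inj_on_def nth_eq_iff_index_eq)
  have "Fs ` {..<l} \<in> minimal_cycles k l"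
    unfolding minimal_cycles_def
  proof (intro CollectI exI[of _ Fs] exI[of _ "(!) vs"] conjI allI impI)
    show "inj_on Fs {..<l}"
    proof (rule inj_onI)
      fix i j assume ij: "i \<in> {..<l}" "j \<in> {..<l}" "Fs i = Fs j"
      show "i = j"
      proof (rule ccontr)
        assume "i \<noteq> j"
        then have "Fs i \<inter> Fs j = ?D i \<inter> ?D j" using Fs(3)[of i j] ij by simp
        then have "Fs i \<subseteq> ?D i" using ij(3) by blast
        then show False using Fs(2)[of i] ij(1) by blast
      qed
    qed
    fix i assume i: "i < l"
    show "finite (Fs i)" "card (Fs i) = k" using mem(1,2) Fs(1)[OF i] by blast+
    show "{vs ! i, vs ! (Suc i mod l)} \<subseteq> Fs i" using Fs(2)[OF i] by blast
  next
    fix i j assume i: "i < l" and j: "j < l" and ij: "i \<noteq> j \<and> j \<noteq> Suc i mod l \<and> i \<noteq> Suc j mod l"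
    have lt: "Suc i mod l < l" "Suc j mod l < l" using i by auto
    have ne: "Suc i mod l \<noteq> Suc j mod l" using i j ij by (auto simp: mod_Suc split: if_splits)
    have nth: "vs ! a \<noteq> vs ! b" if "a < l" "b < l" "a \<noteq> b" for a b
      using that vs by (simp add: nth_eq_iff_index_eq)
    have e: "vs ! a \<noteq> e \<or> \<not> l \<le> b + q" if "a < l" "b < l" for a b
    proof (cases "q = 0")
      case False
      then show ?thesis using that(1) vs nth_mem by metis
    qed (use that in simp)
    \<comment> \<open>Only the indices \<open>l - 2\<close> and \<open>l - 1\<close> can carry
      \<open>e\<close>, and these are consecutive.\<close>
    have "\<not> (l \<le> i + q \<and> l \<le> j + q)" using i j ij q by (auto simp: mod_Suc split: if_splits)
    then have "?D i \<inter> ?D j = {}"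
      using nth[OF i j] nth[OF i lt(2)] nth[OF lt(1) j] nth[OF lt ne] e[OF i j] e[OF j i] e[OF lt(1) j] e[OF lt(2) i] ij
      by auto
    then show "Fs i \<inter> Fs j = {}" using Fs(3)[OF i j] ij by simp
  qed (use inj in simp_all)
  moreover have "Fs ` {..<l} \<subseteq> H" using Fs(1) by blast
  ultimately show ?thesis by blast
qed

text \<open>The starting triangle needs \<open>3 - r\<close> points outside \<open>S\<close>: three
  for \<open>m = 2\<close> and two for \<open>m = 3\<close>, which \<open>k \<ge> 5\<close>
  provides; for \<open>m \<ge> 4\<close> it fits inside the trace.\<close>

lemma adj_cycle:
  assumes F0: "F0 \<in> H" and l: "l \<ge> 3" "k * l \<le> s" and k: "k \<ge> 3" and m: "m \<ge> 2" "k \<ge> 5 \<or> m \<ge> 4"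
  obtains vs where "distinct vs" "length vs = l" "successively adj (vs @ [hd vs])"
proof -
  \<comment> \<open>With \<open>r\<close> points of \<open>S\<close> in the triangle, each of its pairs misses at least two points of the trace.\<close>
  define r :: nat where "r = (if m = 2 then 0 else if m = 3 then 1 else 3)"
  have f: "finite F0" "card F0 = k" "card (F0 \<inter> S) = m" using mem F0 by blast+
  have "card (F0 - S) = k - m" using f by (metis card_Diff_subset_Int finite_Int)
  then have "3 - r \<le> card (F0 - S)" using m unfolding r_def by (auto split: if_splits)
  then obtain t1 where t1: "t1 \<subseteq> F0 - S" "card t1 = 3 - r" by (meson obtain_subset_with_card_n)
  have "r \<le> card (F0 \<inter> S)" using f m unfolding r_def by (auto split: if_splits)
  then obtain t2 where t2: "t2 \<subseteq> F0 \<inter> S" "card t2 = r" by (meson obtain_subset_with_card_n)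
  have fin: "finite t1" "finite t2" using t1 t2 f(1) finite_subset by blast+
  have "t1 \<inter> t2 = {}" using t1 t2 by blast
  then have "card (t1 \<union> t2) = 3" using fin t1 t2 by (simp add: card_Un_disjoint r_def)
  moreover have "(t1 \<union> t2) \<inter> S = t2" using t1 t2 by blast
  then have "card ((t1 \<union> t2) \<inter> S) = r" using t2 by simp
  moreover have "t1 \<union> t2 \<subseteq> F0" using t1 t2 by blast
  moreover have "m \<ge> 2 + min 2 r" using m unfolding r_def by auto
  moreover have "l - 3 + 3 \<le> s"
  proof -
    have "1 * l \<le> k * l" using k by (intro mult_le_mono1) simp
    then show ?thesis using l by linarith
  qed
  ultimately obtain x z y rest where "distinct (x # z # y # rest)"
    "successively adj (x # z # y # rest @ [x])" "length rest = l - 3"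
    using triangle_cycle[OF F0, of "t1 \<union> t2" r "l - 3"] k by blast
  then show ?thesis using that[of "x # z # y # rest"] l(1) by simp
qed

lemma minimal_cycle_of_adj:
  assumes "distinct vs" "length vs = l" "successively adj (vs @ [hd vs])" "k * l \<le> s" "k > 0"
  shows "\<exists>C\<in>minimal_cycles k l. C \<subseteq> H"
  using successively_cycle_nth[OF assms(3)] assms(2)
  by (intro minimal_cycle[OF assms(1,2) _ _ _ assms(4,5), of 0]) (auto simp: adj_def)

section \<open>Four-element sets with trace of size two or three\<close>

text \<open>A mixed pair misses two of the three trace points, whereas a pair inside
  \<open>S\<close> would miss exactly one. Hence the paths built from such edges alternate between
  \<open>S\<close> and its complement.\<close>

lemma mixed_adj:
  assumes "k = 4" "m = 3" "F \<in> H" "a \<in> F" "a \<in> S" "c \<in> F" "c \<notin> S"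
  shows "adj a c" "adj c a"
proof -
  have "{a, c} \<inter> S = {a}" using assms by auto
  then show "adj a c" using assms by (intro adjI[of F]) simp_all
  then show "adj c a" by (simp add: adj_commute)
qed

text \<open>Two vertices are inserted after \<open>a1\<close> in each step: first a fresh
  \<open>p\<close> in \<open>S\<close> from a member through \<open>a1\<close> and \<open>c\<close>,
  then a fresh \<open>c'\<close> outside \<open>S\<close> replacing \<open>c\<close> in that member.
  The vertex \<open>a3\<close> is kept off the path so that it remains available for closing
  it.\<close>

lemma even_path:
  assumes k: "k = 4" and m: "m = 3"
    and F0: "F0 \<in> H" "c0 \<in> F0 - S" "a1 \<in> F0 \<inter> S" "a2 \<in> F0 \<inter> S" "a3 \<in> F0 \<inter> S" "a1 \<noteq> a2" "a3 \<noteq> a1" "a3 \<noteq> a2"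
    and n: "2 * n + 7 \<le> s"
  shows "\<exists>c rest F. F \<in> H \<and> a1 \<in> F \<and> c \<in> F \<and> c \<notin> S \<and> distinct (a1 # c # rest @ [a2]) \<and>
    a3 \<notin> set (a1 # c # rest @ [a2]) \<and> successively adj (a1 # c # rest @ [a2]) \<and> length rest = 2 * n"
  using n
proof (induction n)
  case 0
  have "adj a1 c0" "adj c0 a2" using mixed_adj[OF k m F0(1)] F0 by auto
  then show ?case using F0 by (intro exI[of _ c0] exI[of _ "[]"] exI[of _ F0]) auto
next
  case (Suc n)
  then obtain c rest F where F: "F \<in> H" "a1 \<in> F" "c \<in> F" "c \<notin> S" "distinct (a1 # c # rest @ [a2])"
    "a3 \<notin> set (a1 # c # rest @ [a2])" "successively adj (a1 # c # rest @ [a2])" "length rest = 2 * n" by auto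
  let ?xs = "a1 # c # rest @ [a2]"
  let ?D = "{a1, c}"
  let ?X = "insert a3 (set ?xs)"
  have a1S: "a1 \<in> S" using F0 by blast
  have fin: "finite F" using mem(1) F(1) by blast
  have "card ?D \<le> 2" by (simp add: card_insert_if)
  then have "?D \<noteq> F" using mem(2)[OF F(1)] k by auto
  then have DF: "?D \<subset> F" using F(2,3) by blast
  have "?D \<inter> S = {a1}" using F(4) a1S by blast
  then have c2: "card ((F - ?D) \<inter> S) = 2"
    using card_Int_Diff_split[OF fin psubset_imp_subset[OF DF], of S] mem(3)[OF F(1)] m by simp
  then obtain v where v: "v \<in> F - ?D" "v \<in> S" by (metis Int_iff card.empty equals0I zero_neq_numeral)
  have cX: "card ?X \<le> 2 * n + 4" using distinct_card[OF F(5)] F(6,8) by simp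
  then have X: "finite ?X" "card ?X < s" using Suc.prems by simp_all
  have c2': "card ((F - ?D) \<inter> S) \<noteq> 1" using c2 by simp
  obtain F' p where F': "F' \<in> H" "?D \<subset> F'" "F' \<inter> ?X \<subseteq> ?D" "p \<in> F' - ?D" "p \<in> S \<longleftrightarrow> v \<in> S"
    by (rule replace_vertex[OF F(1) DF c2' X v(1)])
  have p: "p \<notin> ?X" "p \<in> S" "p \<noteq> c" "p \<noteq> a1" using F'(3,4,5) v(2) by auto
  let ?D' = "F' - {c}"
  \<comment> \<open>The second replacement avoids at most \<open>4 + (2 * n + 4)\<close> points,
    which is below \<open>s\<close> since \<open>2 * Suc n + 7 \<le> s\<close>.\<close>
  let ?X' = "F' \<union> ?X"
  have finF': "finite F'" "card F' = 4" using mem(1,2) F'(1) k by auto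
  have "card ?X' \<le> card F' + card ?X" by (rule card_Un_le)
  then have X': "finite ?X'" "card ?X' < s" using finF' cX Suc.prems by auto
  have cF': "c \<in> F'" using F'(2) by blast
  then have D'F: "?D' \<subset> F'" "c \<in> F' - ?D'" by auto
  have "(F' - ?D') \<inter> S = {}" using F(4) by blast
  then have c0': "card ((F' - ?D') \<inter> S) \<noteq> 1" by (metis card.empty zero_neq_one)
  obtain F'' c' where F'': "F'' \<in> H" "?D' \<subset> F''" "F'' \<inter> ?X' \<subseteq> ?D'" "c' \<in> F'' - ?D'" "c' \<in> S \<longleftrightarrow> c \<in> S"
    by (rule replace_vertex[OF F'(1) D'F(1) c0' X' D'F(2)])
  have c': "c' \<notin> ?X'" "c' \<notin> S" using F''(3,4,5) F(4) by auto
  have in'': "a1 \<in> F''" "p \<in> F''" "c' \<in> F''" using F''(2,4) F'(2,4) p F(4) a1S by auto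
  have "adj a1 c'" "adj c' p" "adj p c"
    using mixed_adj[OF k m F''(1) in''(1) a1S in''(3) c'(2)] mixed_adj[OF k m F''(1) in''(2) p(2) in''(3) c'(2)]
      mixed_adj[OF k m F'(1) _ p(2) cF' F(4)] F'(4) by auto
  then have "successively adj (a1 # c' # (p # c # rest) @ [a2])" using F(7) by simp
  moreover have "distinct (a1 # c' # (p # c # rest) @ [a2])" "a3 \<notin> set (a1 # c' # (p # c # rest) @ [a2])"
    using F(5,6) c'(1) p F'(4) by auto
  moreover have "length (p # c # rest) = 2 * Suc n" using F(8) by simp
  ultimately show ?case using F''(1) in'' c'(2) by blast
qed

text \<open>The triple contains the whole trace, so it misses no trace point.\<close>

lemma link_triple:
  assumes "k = 4" "F \<in> H" "F \<inter> S = {a, b}" "x \<in> F" "x \<notin> S"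
  shows "{a, b, x} \<subset> F" "card ((F - {a, b, x}) \<inter> S) \<noteq> 1" "has_star s H {a, b, x}"
proof -
  have "card {a, b, x} \<le> 3" by (simp add: card_insert_if)
  then have "{a, b, x} \<noteq> F" using mem(2)[OF assms(2)] assms(1) by auto
  then show 1: "{a, b, x} \<subset> F" using assms(3,4) by blast
  have "(F - {a, b, x}) \<inter> S = {}" using assms(3) by blast
  then show 2: "card ((F - {a, b, x}) \<inter> S) \<noteq> 1" by (metis card.empty zero_neq_one)
  show "has_star s H {a, b, x}" by (rule star[OF assms(2) 1 2])
qed

text \<open>Edges outside \<open>S\<close> miss both trace points and so are kernel pairs. The path
  grows at its front, whose vertex stays in a member with trace \<open>{a, b}\<close>; the star at
  the far end comes from the initial single vertex.\<close>

lemma link_path: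
  assumes k: "k = 4" and m: "m = 2" and F0: "F0 \<in> H" "F0 \<inter> S = {a, b}" and n: "n + 2 \<le> s"
  shows "\<exists>x rest F. F \<in> H \<and> F \<inter> S = {a, b} \<and> x \<in> F \<and> distinct (x # rest) \<and> set (x # rest) \<inter> S = {} \<and>
    successively adj (x # rest) \<and> length rest = n \<and> has_star s H {a, b, last (x # rest)}"
  using n
proof (induction n)
  case 0
  have "card (F0 \<inter> S) < card F0" using mem(2,3)[OF F0(1)] k m by simp
  then obtain x where x: "x \<in> F0" "x \<notin> S" by (metis Int_absorb2 less_irrefl subsetI)
  then show ?case using F0 link_triple(3)[OF k F0 x]
    by (intro exI[of _ x] exI[of _ "[]"] exI[of _ F0]) simp
next
  case (Suc n)
  then obtain x rest F where F: "F \<in> H" "F \<inter> S = {a, b}" "x \<in> F" "distinct (x # rest)"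
    "set (x # rest) \<inter> S = {}" "successively adj (x # rest)" "length rest = n"
    "has_star s H {a, b, last (x # rest)}" by auto
  have xS: "x \<notin> S" using F(5) by auto
  let ?D = "{a, b, x}"
  note D = link_triple[OF k F(1,2,3) xS]
  obtain y where y: "y \<in> F - ?D" using D(1) by blast
  have yS: "y \<notin> S" using y F(2) by blast
  have "card (set (x # rest)) < s" using distinct_card[OF F(4)] F(7) Suc.prems by simp
  from replace_vertex[OF F(1) D(1,2) finite_set this y]
  obtain F' z where F': "F' \<in> H" "?D \<subset> F'" "F' \<inter> set (x # rest) \<subseteq> ?D" "z \<in> F' - ?D" "z \<in> S \<longleftrightarrow> y \<in> S" .
  have ab: "{a, b} \<subseteq> S" using F(2) by blast
  have zS: "z \<notin> S" using F'(5) yS by simp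
  have z: "z \<notin> set (x # rest)" using F'(3,4) by blast
  have "{a, b} \<subseteq> F' \<inter> S" using F'(2) ab by blast
  moreover have "card (F' \<inter> S) \<le> card {a, b}" using mem(3)[OF F'(1)] mem(3)[OF F(1)] F(2) by simp
  moreover have "finite (F' \<inter> S)" using mem(1)[OF F'(1)] by simp
  ultimately have F'S: "F' \<inter> S = {a, b}" by (metis card_seteq)
  have "{z, x} \<inter> S = {}" using zS xS by simp
  then have "adj z x" using F' k m by (intro adjI[of F']) auto
  then have "successively adj (z # x # rest)" using F(6) by simp
  moreover have "distinct (z # x # rest)" "set (z # x # rest) \<inter> S = {}" using z F(4,5) zS by auto
  moreover have "has_star s H {a, b, last (z # x # rest)}" using F(8) by simp
  moreover have "length (x # rest) = Suc n" using F(7) by simp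
  ultimately show ?case using F'(1,4) F'S by blast
qed

text \<open>A path of even length from \<open>a1\<close> to \<open>a2\<close> closes up either through the triple \<open>{a1, a2, a3}\<close> or
  through a new vertex outside \<open>S\<close>, depending on the parity of \<open>l\<close>.\<close>

lemma minimal_cycle_trace3:
  assumes k: "k = 4" and m: "m = 3" and F0: "F0 \<in> H" and l: "l \<ge> 3" "k * l \<le> s"
  shows "\<exists>C\<in>minimal_cycles k l. C \<subseteq> H"
proof -
  have f: "finite F0" "card F0 = 4" "card (F0 \<inter> S) = 3" using mem[OF F0] k m by simp_all
  obtain a1 a2 a3 where a: "F0 \<inter> S = {a1, a2, a3}" "a1 \<noteq> a2" "a3 \<noteq> a1" "a3 \<noteq> a2"
    using f(3) unfolding card_3_iff by blast
  have "F0 \<noteq> F0 \<inter> S" using f(2,3) by auto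
  then obtain c0 where c0: "c0 \<in> F0 - S" by blast
  let ?D = "{a1, a2, a3}"
  have D: "?D \<subset> F0" "c0 \<in> F0 - ?D" using a(1) c0 by blast+
  have "(F0 - ?D) \<inter> S = {}" using a(1) by blast
  then have c: "card ((F0 - ?D) \<inter> S) \<noteq> 1" by (metis card.empty zero_neq_one)
  have in0: "a1 \<in> F0 \<inter> S" "a2 \<in> F0 \<inter> S" "a3 \<in> F0 \<inter> S" using a(1) by auto
  show ?thesis
  proof (cases "odd l")
    case True
    then obtain n' where "l = 2 * n' + 1" by (rule oddE)
    then obtain n where n: "l = 2 * n + 3" using l(1) by (intro that[of "n' - 1"]) simp
    have "2 * n + 7 \<le> s" using n l k by simp
    from even_path[OF k m F0 c0 in0 a(2,3,4) this] obtain c rest where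
      p: "distinct (a1 # c # rest @ [a2])" "a3 \<notin> set (a1 # c # rest @ [a2])"
        "successively adj (a1 # c # rest @ [a2])" "length rest = 2 * n" by blast
    let ?vs = "a1 # c # rest @ [a2]"
    have len: "length ?vs = l" using p(4) n by simp
    show ?thesis
    \<comment> \<open>Here \<open>q = 1\<close> and \<open>e = a3\<close>: the path already has
      \<open>l\<close> vertices, and the closing edge from \<open>a2\<close> to \<open>a1\<close> is
      the triple.\<close>
    proof (rule minimal_cycle[OF p(1) len _ _ _ l(2)])
      fix i assume i: "i < l"
      show "has_star s H ({?vs ! i, ?vs ! (Suc i mod l)} \<union> (if l \<le> i + 1 then {a3} else {}))"
      proof (cases "Suc i = l")
        case True
        then have "i = length (a1 # c # rest)" using len by simp
        then have "?vs ! i = a2" by (simp add: nth_append)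
        moreover have "Suc i mod l = 0" using True by simp
        ultimately show ?thesis using True star[OF F0 D(1) c] by (simp add: insert_commute)
      next
        case False
        then have "adj (?vs ! i) (?vs ! Suc i)" using i len by (intro successively_nth[OF p(3)]) simp
        moreover have "Suc i mod l = Suc i" using False i by simp
        ultimately show ?thesis using False i by (simp add: adj_def del: nth_Cons_Suc)
      qed
    qed (use p k in auto)
  next
    case False
    then obtain n' where "l = 2 * n'" by blast
    then obtain n where n: "l = 2 * n + 4" using l(1) by (intro that[of "n' - 2"]) simp
    have "2 * n + 7 \<le> s" using n l k by simp
    from even_path[OF k m F0 c0 in0 a(2,3,4) this] obtain c rest where
      p: "distinct (a1 # c # rest @ [a2])"
        "successively adj (a1 # c # rest @ [a2])" "length rest = 2 * n" by blast
    let ?vs = "a1 # c # rest @ [a2]"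
    have len: "length ?vs = 2 * n + 3" using p(3) by simp
    then have "card (set ?vs) < s" using distinct_card[OF p(1)] n l(2) k by simp
    \<comment> \<open>For even \<open>l\<close> one vertex is still missing. A fresh
      \<open>c'\<close> outside \<open>S\<close>, in a member through the triple, is adjacent to
      both \<open>a2\<close> and \<open>a1\<close>.\<close>
    from replace_vertex[OF F0 D(1) c finite_set this D(2)]
    obtain F' c' where F': "F' \<in> H" "?D \<subset> F'" "F' \<inter> set ?vs \<subseteq> ?D" "c' \<in> F' - ?D" "c' \<in> S \<longleftrightarrow> c0 \<in> S" .
    have c': "c' \<notin> S" "c' \<notin> set ?vs" using F'(3,4,5) c0 by auto
    have "adj a2 c'" "adj c' a1"
      using mixed_adj[OF k m F'(1), of a2 c'] mixed_adj[OF k m F'(1), of a1 c'] F'(2,4) in0 c'(1) by auto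
    then have "successively adj (?vs @ [c', a1])"
      unfolding successively_append_iff[of adj ?vs] using p(2) by simp
    then have cyc: "successively adj ((?vs @ [c']) @ [hd (?vs @ [c'])])" by simp
    have "distinct (?vs @ [c'])" using p(1) c'(2) by auto
    moreover have "length (?vs @ [c']) = l" using len n by simp
    ultimately show ?thesis by (rule minimal_cycle_of_adj[OF _ _ cyc l(2)]) (use k in simp)
  qed
qed

text \<open>A path in the link of \<open>{a, b}\<close> closes up through the triples formed by \<open>a, b\<close> and its two ends.\<close>

lemma minimal_cycle_trace2:
  assumes k: "k = 4" and m: "m = 2" and F0: "F0 \<in> H" and l: "l \<ge> 3" "k * l \<le> s"
  shows "\<exists>C\<in>minimal_cycles k l. C \<subseteq> H"
proof -
  have "card (F0 \<inter> S) = 2" using mem(3)[OF F0] m by simp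
  then obtain a b where ab: "F0 \<inter> S = {a, b}" "a \<noteq> b" unfolding card_2_iff by blast
  have "l - 2 + 2 \<le> s" using l k by simp
  from link_path[OF k m F0 ab(1) this] obtain x rest F where
    p: "F \<in> H" "F \<inter> S = {a, b}" "x \<in> F" "distinct (x # rest)" "set (x # rest) \<inter> S = {}"
      "successively adj (x # rest)" "length rest = l - 2" "has_star s H {a, b, last (x # rest)}" by blast
  let ?vs = "(x # rest) @ [a]"
  have abS: "a \<in> S" "b \<in> S" using ab(1) by auto
  have xS: "x \<notin> S" using p(5) by auto
  have d: "distinct ?vs" "b \<notin> set ?vs" using p(4,5) abS ab(2) by auto
  have len: "length ?vs = l" "length (x # rest) = l - 1" using p(7) l(1) by simp_all
  show ?thesis
  \<comment> \<open>Here \<open>q = 2\<close> and \<open>e = b\<close>: the two edges at the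
    appended vertex \<open>a\<close> are the triples of \<open>a, b\<close> with the last and the
    first vertex of the path.\<close>
  proof (rule minimal_cycle[OF d(1) len(1) _ _ _ l(2)])
    fix i assume i: "i < l"
    show "has_star s H ({?vs ! i, ?vs ! (Suc i mod l)} \<union> (if l \<le> i + 2 then {b} else {}))"
    proof (cases "i + 2 < l")
      case True
      then have "adj ((x # rest) ! i) ((x # rest) ! Suc i)" using len by (intro successively_nth[OF p(6)]) simp
      moreover have "?vs ! i = (x # rest) ! i" "?vs ! Suc i = (x # rest) ! Suc i"
        using True len(2) by (auto simp: nth_append simp del: append_Cons)
      moreover have "Suc i mod l = Suc i" using True by simp
      ultimately show ?thesis using True by (simp add: adj_def del: nth_Cons_Suc append_Cons)
    next
      case ge: False
      have va: "?vs ! (l - 1) = a" using len(2) by (metis nth_append_length)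
      show ?thesis
      proof (cases "Suc i = l")
        case True
        then have "?vs ! i = a" using va by auto
        moreover have "?vs ! (Suc i mod l) = x" using True by simp
        ultimately have "{?vs ! i, ?vs ! (Suc i mod l)} \<union> (if l \<le> i + 2 then {b} else {}) = {a, b, x}"
          using ge by auto
        then show ?thesis using link_triple(3)[OF k p(1,2,3) xS] by (simp only:)
      next
        case False
        then have i': "i = length (x # rest) - 1" "Suc i = l - 1" using ge i len(2) by auto
        have "?vs ! i = (x # rest) ! i" using i' len(2) l(1) by (auto simp: nth_append simp del: append_Cons)
        also have "\<dots> = last (x # rest)" unfolding i'(1) by (simp add: last_conv_nth)
        finally have "?vs ! i = last (x # rest)" .
        moreover have "?vs ! (Suc i mod l) = a" using i'(2) va l(1) by simp
        ultimately have "{?vs ! i, ?vs ! (Suc i mod l)} \<union> (if l \<le> i + 2 then {b} else {}) = {a, b, last (x # rest)}"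
          using ge by auto
        then show ?thesis using p(8) by (simp only:)
      qed
    qed
  qed (use d k in auto)
qed

lemma minimal_cycle_exists:
  assumes k: "k = 4" and m: "m \<ge> 2" and F0: "F0 \<in> H" and l: "l \<ge> 3" "k * l \<le> s"
  shows "\<exists>C\<in>minimal_cycles k l. C \<subseteq> H"
proof -
  consider "m = 2" | "m = 3" | "m \<ge> 4" using m by linarith
  then show ?thesis
  proof cases
    case 3
    obtain vs where "distinct vs" "length vs = l" "successively adj (vs @ [hd vs])"
      by (rule adj_cycle[OF F0 l _ m]) (use k 3 in auto)
    then show ?thesis by (rule minimal_cycle_of_adj[OF _ _ _ l(2)]) (use k in simp)
  qed (use minimal_cycle_trace2 minimal_cycle_trace3 assms in auto)
qed

lemma linear_cycle_exists:
  assumes k: "k \<ge> 5" and m: "m \<ge> 2" and F0: "F0 \<in> H" and l: "l \<ge> 3" "k * l \<le> s"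
  shows "\<exists>C\<in>linear_cycles k l. C \<subseteq> H"
proof -
  obtain vs where vs: "distinct vs" "length vs = l" "successively adj (vs @ [hd vs])"
    by (rule adj_cycle[OF F0 l _ m]) (use k in auto)
  show ?thesis
    by (rule linear_cycle[OF vs(1,2) _ l(2)]) (use successively_cycle_nth[OF vs(3)] vs(2) k in auto)
qed

end

subsection \<open>Centralized families\<close>

text \<open>Settled members supply kernels with graded thresholds, which are now weakened to stars
  of size \<open>s\<close>.\<close>

lemma homog_traced:
  assumes "unif V k H" "homog k s H S m"
  shows "traced H S k s m"
proof
  fix F assume F: "F \<in> H"
  show "finite F" "card F = k" using unif_memD[OF assms(1) F] by auto
  have h: "settled k s H F" "free_pts k s H F = F \<inter> S" "card (F \<inter> S) = m"
    using assms(2) F unfolding homog_def by auto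
  then show "card (F \<inter> S) = m" by simp
  fix D assume D: "D \<subset> F" "card ((F - D) \<inter> S) \<noteq> 1"
  have "(F - D) \<inter> free_pts k s H F = (F - D) \<inter> S" using h(2) by blast
  then have "kern k s H D" using settled_kern[OF h(1) \<open>finite F\<close> D(1)] D(2) by simp
  then show "has_star s H D" by (rule kern_has_star)
qed

lemma centralized_iff:
  assumes "finite G"
  shows "centralized s G \<longleftrightarrow> (\<forall>F\<in>G. \<exists>c\<in>F. \<forall>D. D \<subset> F \<and> c \<in> D \<longrightarrow> has_star s G D)"
  unfolding centralized_def Ker_iff_has_star[OF assms] ..

text \<open>Stars of either family remain stars of the union, so every member keeps its
  centre.\<close>

lemma centralized_Un:
  assumes "finite G" "finite G'" "centralized s G" "centralized s G'"
  shows "centralized s (G \<union> G')"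
proof -
  have fin: "finite (G \<union> G')" using assms by simp
  have mono: "\<exists>c\<in>F. \<forall>D. D \<subset> F \<and> c \<in> D \<longrightarrow> has_star s (G \<union> G') D"
    if K: "K \<subseteq> G \<union> G'" and ex: "\<exists>c\<in>F. \<forall>D. D \<subset> F \<and> c \<in> D \<longrightarrow> has_star s K D" for F K
  proof -
    obtain c where c: "c \<in> F" "\<forall>D. D \<subset> F \<and> c \<in> D \<longrightarrow> has_star s K D" using ex by (rule bexE)
    have "has_star s (G \<union> G') D" if "D \<subset> F \<and> c \<in> D" for D
      using has_star_mono[OF mp[OF spec[OF c(2)] that] K] .
    then show ?thesis by (intro bexI[OF _ c(1)] allI impI)
  qed
  show ?thesis
    unfolding centralized_iff[OF fin]
  proof
    fix F assume "F \<in> G \<union> G'"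
    then show "\<exists>c\<in>F. \<forall>D. D \<subset> F \<and> c \<in> D \<longrightarrow> has_star s (G \<union> G') D"
    proof
      assume "F \<in> G"
      then show ?thesis
        by (intro mono[OF Un_upper1] assms(3)[unfolded centralized_iff[OF assms(1)], THEN bspec])
    next
      assume "F \<in> G'"
      then show ?thesis
        by (intro mono[OF Un_upper2] assms(4)[unfolded centralized_iff[OF assms(2)], THEN bspec])
    qed
  qed
qed

text \<open>The centre is the only trace point, or any point if the trace is empty. A proper subset
  containing it misses no trace point.\<close>

lemma (in traced) centralized_trace_le1:
  assumes "finite H" "m \<le> 1" "k > 0"
  shows "centralized s H"
  unfolding centralized_iff[OF assms(1)]
proof
  fix F assume F: "F \<in> H"
  have f: "finite F" "F \<noteq> {}" using mem(1,2)[OF F] assms(3) by auto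
  have "\<exists>c\<in>F. F \<inter> S \<subseteq> {c}"
  proof (cases "F \<inter> S = {}")
    case False
    then have "card (F \<inter> S) = 1" using mem(3)[OF F] assms(2) f(1) by (metis card_0_eq finite_Int le_antisym less_one not_le)
    then obtain c where "F \<inter> S = {c}" by (rule card_1_singletonE)
    then show ?thesis by blast
  qed (use f in blast)
  then obtain c where c: "c \<in> F" "F \<inter> S \<subseteq> {c}" by blast
  have "has_star s H D" if "D \<subset> F \<and> c \<in> D" for D
  proof (rule star[OF F])
    have "(F - D) \<inter> S = {}" using c(2) that by blast
    then show "card ((F - D) \<inter> S) \<noteq> 1" by (metis card.empty zero_neq_one)
  qed (use that in blast)
  then show "\<exists>c\<in>F. \<forall>D. D \<subset> F \<and> c \<in> D \<longrightarrow> has_star s H D" using c(1) by blast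
qed

theorem theorem8p2:
  fixes k s :: nat
  assumes "k \<ge> 4" and "s > 0"
  shows "\<exists>c::real. c > 0 \<and>
    (\<forall>(l::nat) (n::nat) (F :: nat set set).
       l \<ge> 3 \<and> s \<ge> k * l \<and>
       (\<forall>A\<in>F. A \<subseteq> {1..n} \<and> card A = k) \<and>
       (k = 4 \<longrightarrow> (\<forall>C \<in> minimal_cycles 4 l. \<not> C \<subseteq> F)) \<and>
       (k \<ge> 5 \<longrightarrow> (\<forall>C \<in> linear_cycles k l. \<not> C \<subseteq> F)) \<longrightarrow>
       (\<exists>F1 F0. F1 \<union> F0 = F \<and> F1 \<inter> F0 = {} \<and>
          centralized s F1 \<and>
          real (card F0) \<le> 1 / c * real (n choose (k - 2))))"
proof -
  have k2: "k \<ge> 2" using assms(1) by simp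
  obtain M where M: "\<forall>(V::nat set) G. unif V k G \<and> M * (card V choose (k - 2)) < card G \<longrightarrow>
    (\<exists>H\<subseteq>G. H \<noteq> {} \<and> (\<exists>S m. homog k s H S m))"
    using homog_subfamily[OF k2 assms(2)] by (rule exE)
  show ?thesis
  \<comment> \<open>\<open>M\<close> will bound the remainder; adding 1 avoids a division by zero
    when \<open>M = 0\<close>.\<close>
  proof (intro exI[of _ "1 / (real M + 1)"] conjI allI impI)
    show "1 / (real M + 1) > 0" by simp
    fix l n :: nat and F :: "nat set set"
    assume a: "l \<ge> 3 \<and> s \<ge> k * l \<and>
       (\<forall>A\<in>F. A \<subseteq> {1..n} \<and> card A = k) \<and>
       (k = 4 \<longrightarrow> (\<forall>C \<in> minimal_cycles 4 l. \<not> C \<subseteq> F)) \<and>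
       (k \<ge> 5 \<longrightarrow> (\<forall>C \<in> linear_cycles k l. \<not> C \<subseteq> F))"
    then have l: "l \<ge> 3" "k * l \<le> s" and F: "unif {1..n} k F"
      and no4: "k = 4 \<Longrightarrow> C \<in> minimal_cycles k l \<Longrightarrow> \<not> C \<subseteq> F"
      and no5: "k \<ge> 5 \<Longrightarrow> C \<in> linear_cycles k l \<Longrightarrow> \<not> C \<subseteq> F" for C
      by (auto simp: unif_def)
    have finF: "finite F" by (rule unif_finite[OF F])
    \<comment> \<open>A centralized subfamily of greatest cardinality is selected; the empty family
      shows that candidates exist.\<close>
    let ?P = "\<lambda>j. \<exists>G\<subseteq>F. centralized s G \<and> card G = j"
    have "?P 0" by (rule exI[of _ "{}"]) (simp add: centralized_def)
    moreover have "j \<le> card F" if "?P j" for j using that card_mono[OF finF] by blast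
    ultimately obtain j where j: "?P j" "\<And>i. ?P i \<Longrightarrow> i \<le> j"
      using Nat.ex_has_greatest_nat[of ?P 0 "card F"] by blast
    obtain F1 where F1: "F1 \<subseteq> F" "centralized s F1" "card F1 = j" using j(1) by blast
    have finF1: "finite F1" using F1(1) finF finite_subset by blast
    have "card (F - F1) \<le> M * (n choose (k - 2))"
    proof (rule ccontr)
      assume "\<not> ?thesis"
      moreover have U: "unif {1..n} k (F - F1)" by (rule unif_subset[OF F]) blast
      ultimately have "\<exists>H\<subseteq>F - F1. H \<noteq> {} \<and> (\<exists>S m. homog k s H S m)"
        by (intro M[rule_format, of "{1..n}"]) simp
      then obtain H S m where H: "H \<subseteq> F - F1" "H \<noteq> {}" "homog k s H S m" by blast
      have "traced H S k s m" by (rule homog_traced[OF unif_subset[OF U H(1)] H(3)])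
      then interpret traced H S k s m .
      obtain A where A: "A \<in> H" using H(2) by blast
      have finH: "finite H" using H(1) finF finite_subset by blast
      have HF: "H \<subseteq> F" using H(1) by blast
      show False
      proof (cases "m \<le> 1")
        case True
        have "centralized s H" by (rule centralized_trace_le1[OF finH True]) (use k2 in simp)
        then have "centralized s (F1 \<union> H)" using centralized_Un finF1 finH F1(2) by blast
        then have "card (F1 \<union> H) \<le> j" using F1(1) HF by (intro j(2) exI[of _ "F1 \<union> H"]) blast
        moreover have "card (F1 \<union> H) = card F1 + card H"
          using H(1) finF1 finH by (intro card_Un_disjoint) auto
        moreover have "card H > 0" using H(2) finH by (simp add: card_gt_0_iff)
        ultimately show False using F1(3) by simp
      next
        case False
        then have m: "m \<ge> 2" by simp
        show False
        proof (cases "k = 4")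
          case True
          obtain C where C: "C \<in> minimal_cycles k l" "C \<subseteq> H"
            using minimal_cycle_exists[OF True m A l] by blast
          have "C \<subseteq> F" using C(2) HF by (rule subset_trans)
          then show False using no4[OF True C(1)] by simp
        next
          case False
          then have k5: "k \<ge> 5" using assms(1) by simp
          obtain C where C: "C \<in> linear_cycles k l" "C \<subseteq> H"
            using linear_cycle_exists[OF k5 m A l] by blast
          have "C \<subseteq> F" using C(2) HF by (rule subset_trans)
          then show False using no5[OF k5 C(1)] by simp
        qed
      qed
    qed
    then have "real (card (F - F1)) \<le> real M * real (n choose (k - 2))"
      by (metis of_nat_le_iff of_nat_mult)
    also have "\<dots> \<le> 1 / (1 / (real M + 1)) * real (n choose (k - 2))"
      by (intro mult_right_mono) auto
    finally show "\<exists>F1 F0. F1 \<union> F0 = F \<and> F1 \<inter> F0 = {} \<and> centralized s F1 \<and>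
          real (card F0) \<le> 1 / (1 / (real M + 1)) * real (n choose (k - 2))"
      using F1(1,2) by (intro exI[of _ F1] exI[of _ "F - F1"]) auto
  qed
qed

end
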